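(* Let $n\ge 1$ and let $\omega\in L^1_{\mathcal F}(\mathbb R)$ be the weight of a P\'olya ensemble on $H_2=\mathrm{Herm}(n)$, so that the joint probability density of the eigenvalues is $$p_D(x)=\frac{1}{n!}\left(\prod_{j=0}^{n-1}\frac{1}{\mathcal F\omega(0)\,j!}\right)\Delta_n(x)\det\left[(-\partial_{x_a})^{b-1}\omega(x_a)\right]_{a,b=1,\ldots,n},\qquad x\in\mathbb R^n .$$ Then this joint probability density can be described by the bi-orthonormal functions $\{p_j,q_j\}_{j=0,\ldots,n-1}$ on $\mathbb R$ given by $$p_j(y')=\left.\frac{(y'-\imath\partial_t)^j}{j!}\frac{1}{\mathcal F\omega(t)}\right|_{t=0},\qquad q_j(y)=(-\partial_y)^j\omega(y),\qquad j=0,\ldots,n-1,$$ and its kernel is $$K_n(y',y)=\frac{1}{(n-1)!}\int_0^\infty ds\, e^{-s}\left.\bigl(s-(y'-\imath\partial_t)\partial_y\bigr)^{n-1}\frac{\omega(y)}{\mathcal F\omega(t)}\right|_{t=0}.$$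
   Context: Notation: $\imath=\sqrt{-1}$; $\Delta_n(x)=\prod_{1\le b<c\le n}(x_c-x_b)$; $\mathcal F f(s)=\int_{-\infty}^\infty f(x)e^{\imath xs}dx$. $L^1_{\mathcal F}(\mathbb R)$ is the set of $f\in L^1(\mathbb R)$ that are non-negative, $(n-1)$-times differentiable and satisfy $\int_{-\infty}^\infty |x^{\kappa-1}f^{(j)}(x)|dx<\infty$ for all $\kappa\in[1,n]$ and $j=0,\ldots,n-1$. P\'olya ensemble on $H_2$: a random Hermitian $n\times n$ matrix whose law has a density (with respect to Lebesgue measure) invariant under conjugation by $\mathrm U(n)$, and whose unordered eigenvalues have joint probability density on $\mathbb R^n$ proportional to $\Delta_n(x)\det[w_b(x_c)]_{b,c=1}^n\ge 0$ with $w_j=(-\partial_x)^{j-1}\omega$, $\omega\in L^1_{\mathcal F}(\mathbb R)$; $\omega$ is called the associated weight. Description by bi-orthonormal functions: a density proportional to $\Delta_n(x)\det[w_b(x_c)]$ on $\mathbb R^n$ is described by $\{p_j,q_j\}_{j=0,\ldots,n-1}$ if $\int_{\mathbb R}p_l(x)q_m(x)dx=\delta_{lm}$ for $l,m=0,\ldots,n-1$, the linear span of $\{p_j\}$ equals that of $\{x^j\}_{j=0,\ldots,n-1}$, and the linear span of $\{q_j\}$ equals that of $\{w_{j+1}\}_{j=0,\ldots,n-1}$. The corresponding kernel is $K_n(y',y)=\sum_{j=0}^{n-1}p_j(y')q_j(y)$. In the formulas, $\partial_t$ acts on $1/\mathcal F\omega(t)$, $\partial_y$ acts on $\omega(y)$,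 and $y'$ is a parameter commuting with both. *)

theory Defs
  imports
    "HOL-Probability.Probability"
    "Jordan_Normal_Form.Schur_Decomposition"
begin

text \<open>
  Indices are zero-based: the weights $w_1, \dots, w_n$ are \<open>w 0, \<dots>, w (n - 1)\<close>. A point of
  $R^n$ is an extensional function on \<open>{..<n}\<close>. The matrices are those of the entry
  Jordan_Normal_Form, so that the size may depend on a natural number.
\<close>

abbreviation Rn :: "nat \<Rightarrow> (nat \<Rightarrow> real) measure" where
  "Rn n \<equiv> Pi\<^sub>M {..<n} (\<lambda>_. lborel)"

definition vandermonde :: "nat \<Rightarrow> (nat \<Rightarrow> real) \<Rightarrow> real" where
  "vandermonde n x = (\<Prod>c<n. \<Prod>b<c. x c - x b)"

definition fourier :: "(real \<Rightarrow> real) \<Rightarrow> real \<Rightarrow> complex" where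
  "fourier f s = (\<integral>x. complex_of_real (f x) * exp (\<i> * complex_of_real (x * s)) \<partial>lborel)"

definition minus_D :: "(real \<Rightarrow> real) \<Rightarrow> real \<Rightarrow> real" where
  "minus_D f = (\<lambda>x. - deriv f x)"

text \<open>
  The exponent \<open>\<kappa>\<close> is real, so $|x^{\kappa-1}|$ is \<open>\<bar>x\<bar> powr (\<kappa> - 1)\<close>. This differs from it only at
  \<open>x = 0\<close>, \<open>\<kappa> = 1\<close>, because \<open>0 powr 0 = 0\<close>.
\<close>

definition L1F :: "nat \<Rightarrow> (real \<Rightarrow> real) set" where
  "L1F n = {f. integrable lborel f \<and> (\<forall>x. 0 \<le> f x)
     \<and> (\<forall>j<n-1. \<forall>x. (deriv ^^ j) f differentiable (at x))
     \<and> (\<forall>\<kappa>\<in>{1..real n}. \<forall>j\<le>n-1.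
          integrable lborel (\<lambda>x. \<bar>x\<bar> powr (\<kappa> - 1) * (deriv ^^ j) f x))}"


subsection \<open>Random Hermitian matrices\<close>

text \<open>
  The real coordinates of a Hermitian matrix are its diagonal \<open>h (i, i)\<close> and, for \<open>i < j\<close>, the
  real part \<open>h (i, j)\<close> and the imaginary part \<open>h (j, i)\<close> of its entry at \<open>(i, j)\<close>. Lebesgue
  measure on Herm(n) is Lebesgue measure in these coordinates; another normalisation would
  only rescale densities.
\<close>

definition herm_mat :: "nat \<Rightarrow> (nat \<times> nat \<Rightarrow> real) \<Rightarrow> complex mat" where
  "herm_mat n h = mat n n (\<lambda>(i, j).
     if i = j then complex_of_real (h (i, i))
     else if i < j then Complex (h (i, j)) (h (j, i))
     else Complex (h (j, i)) (- h (i, j)))"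

definition herm_lborel :: "nat \<Rightarrow> complex mat measure" where
  "herm_lborel n = embed_measure (Pi\<^sub>M ({..<n} \<times> {..<n}) (\<lambda>_. lborel)) (herm_mat n)"

lemma inj_on_herm_mat:
  "inj_on (herm_mat n) (space (Pi\<^sub>M ({..<n} \<times> {..<n}) (\<lambda>_. lborel)))"
proof (rule inj_onI)
  fix g h assume g: "g \<in> space (Pi\<^sub>M ({..<n} \<times> {..<n}) (\<lambda>_. lborel))"
    and h: "h \<in> space (Pi\<^sub>M ({..<n} \<times> {..<n}) (\<lambda>_. lborel))"
    and eq: "herm_mat n g = herm_mat n h"
  have e: "herm_mat n g $$ (i, j) = herm_mat n h $$ (i, j)" for i j
    by (simp add: eq)
  have "g (i, j) = h (i, j)" if "i < n" "j < n" for i j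
    using e[of i j] e[of j i] that
    by (cases i j rule: linorder_cases) (auto simp: herm_mat_def)
  then show "g = h"
    using g h by (intro PiE_ext[of g _ _ h]) (auto simp: space_PiM)
qed

lemma space_herm_lborel:
  "space (herm_lborel n) = {A \<in> carrier_mat n n. mat_adjoint A = A}"
proof (intro equalityI subsetI)
  fix A assume "A \<in> space (herm_lborel n)"
  then obtain h where A: "A = herm_mat n h"
    by (auto simp: herm_lborel_def space_embed_measure)
  have "mat_adjoint A = A"
    by (rule eq_matI)
      (auto simp: A mat_adjoint_def herm_mat_def mat_of_rows_index complex_eq_iff)
  then show "A \<in> {A \<in> carrier_mat n n. mat_adjoint A = A}"
    by (simp add: A herm_mat_def)
next
  fix A :: "complex mat" assume "A \<in> {A \<in> carrier_mat n n. mat_adjoint A = A}"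
  then have A: "A \<in> carrier_mat n n" and adj: "mat_adjoint A = A" by auto
  have c: "A $$ (i, j) = cnj (A $$ (j, i))" if "i < n" "j < n" for i j
  proof -
    have "A $$ (i, j) = mat_adjoint A $$ (i, j)" by (simp add: adj)
    also have "\<dots> = cnj (A $$ (j, i))"
      using A that by (auto simp: mat_adjoint_def mat_of_rows_index)
    finally show ?thesis .
  qed
  define h where "h = restrict (\<lambda>(i, j). if i \<le> j then Re (A $$ (i, j)) else Im (A $$ (j, i)))
    ({..<n} \<times> {..<n})"
  have "A = herm_mat n h"
  proof (rule eq_matI)
    fix i j assume "i < dim_row (herm_mat n h)" "j < dim_col (herm_mat n h)"
    then have ij: "i < n" "j < n" by (auto simp: herm_mat_def)
    show "A $$ (i, j) = herm_mat n h $$ (i, j)"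
      using c[OF ij] c[OF ij(2,1)] ij
      by (auto simp: herm_mat_def h_def complex_eq_iff)
  qed (use A in \<open>auto simp: herm_mat_def\<close>)
  moreover have "h \<in> space (Pi\<^sub>M ({..<n} \<times> {..<n}) (\<lambda>_. lborel))"
    by (auto simp: space_PiM h_def)
  ultimately show "A \<in> space (herm_lborel n)"
    by (auto simp: herm_lborel_def space_embed_measure)
qed

definition eigenvalue_tuple :: "nat \<Rightarrow> complex mat \<Rightarrow> (nat \<Rightarrow> real) \<Rightarrow> bool" where
  "eigenvalue_tuple n A x \<longleftrightarrow> char_poly A = (\<Prod>i<n. [:- complex_of_real (x i), 1:])"

text \<open>
  The unordered eigenvalues have joint density \<open>\<rho>\<close> on $R^n$: \<open>\<rho>\<close> is symmetric, and permutation
  invariant events have the probability that \<open>\<rho>\<close> assigns to them. For such an event it does not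
  matter how the eigenvalues are labelled.
\<close>

definition joint_eigenvalue_density ::
  "'a measure \<Rightarrow> nat \<Rightarrow> ('a \<Rightarrow> complex mat) \<Rightarrow> ((nat \<Rightarrow> real) \<Rightarrow> real) \<Rightarrow> bool" where
  "joint_eigenvalue_density M n X \<rho> \<longleftrightarrow>
     \<rho> \<in> borel_measurable (Rn n)
     \<and> (\<forall>x\<in>space (Rn n). 0 \<le> \<rho> x)
     \<and> (\<forall>x\<in>space (Rn n). \<forall>\<sigma>. \<sigma> permutes {..<n} \<longrightarrow> \<rho> (x \<circ> \<sigma>) = \<rho> x)
     \<and> (\<forall>B\<in>sets (Rn n). (\<forall>x\<in>B. \<forall>\<sigma>. \<sigma> permutes {..<n} \<longrightarrow> x \<circ> \<sigma> \<in> B) \<longrightarrow>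
          {\<omega>\<in>space M. \<exists>x\<in>B. eigenvalue_tuple n (X \<omega>) x} \<in> sets M
          \<and> emeasure M {\<omega>\<in>space M. \<exists>x\<in>B. eigenvalue_tuple n (X \<omega>) x}
              = (\<integral>\<^sup>+x\<in>B. ennreal (\<rho> x) \<partial>Rn n))"

definition proportional_to_vandermonde_det ::
  "nat \<Rightarrow> (nat \<Rightarrow> real \<Rightarrow> real) \<Rightarrow> ((nat \<Rightarrow> real) \<Rightarrow> real) \<Rightarrow> bool" where
  "proportional_to_vandermonde_det n w \<rho> \<longleftrightarrow>
     (\<exists>C>0. \<forall>x\<in>space (Rn n).
        \<rho> x = C * (vandermonde n x * Determinant.det (mat n n (\<lambda>(b, c). w b (x c)))))"

definition unitarily_invariant :: "nat \<Rightarrow> (complex mat \<Rightarrow> ennreal) \<Rightarrow> bool" where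
  "unitarily_invariant n f \<longleftrightarrow>
     (\<forall>A\<in>space (herm_lborel n). \<forall>U\<in>carrier_mat n n.
        U * mat_adjoint U = 1\<^sub>m n \<longrightarrow> f (U * A * mat_adjoint U) = f A)"

definition polya_ensemble ::
  "'a measure \<Rightarrow> nat \<Rightarrow> ('a \<Rightarrow> complex mat) \<Rightarrow> (real \<Rightarrow> real) \<Rightarrow> bool" where
  "polya_ensemble M n X \<omega> \<longleftrightarrow>
     prob_space M
     \<and> \<omega> \<in> L1F n
     \<and> (\<exists>f. distributed M (herm_lborel n) X f \<and> unitarily_invariant n f)
     \<and> (\<exists>\<rho>. joint_eigenvalue_density M n X \<rho>
           \<and> proportional_to_vandermonde_det n (\<lambda>j. (minus_D ^^ j) \<omega>) \<rho>)"

text \<open>The transform of a real function is real at \<open>0\<close>, so \<open>Re\<close> discards nothing.\<close>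

definition polya_density :: "nat \<Rightarrow> (real \<Rightarrow> real) \<Rightarrow> (nat \<Rightarrow> real) \<Rightarrow> real" where
  "polya_density n \<omega> x =
     1 / fact n * (\<Prod>j<n. 1 / (Re (fourier \<omega> 0) * fact j))
       * vandermonde n x * Determinant.det (mat n n (\<lambda>(a, b). (minus_D ^^ b) \<omega> (x a)))"


subsection \<open>Bi-orthonormal description and kernel\<close>

definition complex_lin_span :: "nat \<Rightarrow> (nat \<Rightarrow> real \<Rightarrow> complex) \<Rightarrow> (real \<Rightarrow> complex) set" where
  "complex_lin_span n f = {g. \<exists>c. g = (\<lambda>x. \<Sum>j<n. c j * f j x)}"

text \<open>
  A density proportional to the product of the Vandermonde determinant and \<open>det [w_b (x_c)]\<close> is
  described by \<open>p\<close> and \<open>q\<close>. Using \<open>has_bochner_integral\<close> makes the existence of the integrals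
  part of the bi-orthonormality.
\<close>

definition described_by_biorthonormal ::
  "nat \<Rightarrow> ((nat \<Rightarrow> real) \<Rightarrow> real) \<Rightarrow> (nat \<Rightarrow> real \<Rightarrow> real) \<Rightarrow>
   (nat \<Rightarrow> real \<Rightarrow> complex) \<Rightarrow> (nat \<Rightarrow> real \<Rightarrow> complex) \<Rightarrow> bool" where
  "described_by_biorthonormal n \<rho> w p q \<longleftrightarrow>
     proportional_to_vandermonde_det n w \<rho>
     \<and> (\<forall>l<n. \<forall>m<n. has_bochner_integral lborel (\<lambda>x. p l x * q m x) (if l = m then 1 else 0))
     \<and> complex_lin_span n p = complex_lin_span n (\<lambda>j x. complex_of_real x ^ j)
     \<and> complex_lin_span n q = complex_lin_span n (\<lambda>j x. complex_of_real (w j x))"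

definition biorthonormal_kernel ::
  "nat \<Rightarrow> (nat \<Rightarrow> real \<Rightarrow> complex) \<Rightarrow> (nat \<Rightarrow> real \<Rightarrow> complex) \<Rightarrow> real \<Rightarrow> real \<Rightarrow> complex" where
  "biorthonormal_kernel n p q y' y = (\<Sum>j<n. p j y' * q j y)"

text \<open>The operator $y' - \imath \partial_t$ on functions of \<open>t\<close>.\<close>

definition param_minus_iD :: "real \<Rightarrow> (real \<Rightarrow> complex) \<Rightarrow> real \<Rightarrow> complex" where
  "param_minus_iD y' g = (\<lambda>t. complex_of_real y' * g t - \<i> * vector_derivative g (at t))"

text \<open>The operator $s - (y' - \imath \partial_t) \partial_y$ on functions \<open>F t y\<close> of two variables.\<close>

definition kernel_operator ::
  "real \<Rightarrow> real \<Rightarrow> (real \<Rightarrow> real \<Rightarrow> complex) \<Rightarrow> real \<Rightarrow> real \<Rightarrow> complex" where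
  "kernel_operator s y' F = (\<lambda>t y. complex_of_real s * F t y
     - param_minus_iD y' (\<lambda>\<tau>. vector_derivative (F \<tau>) (at y)) t)"

definition polya_p :: "(real \<Rightarrow> real) \<Rightarrow> nat \<Rightarrow> real \<Rightarrow> complex" where
  "polya_p \<omega> j y' = (param_minus_iD y' ^^ j) (\<lambda>t. 1 / fourier \<omega> t) 0 / fact j"

definition polya_q :: "(real \<Rightarrow> real) \<Rightarrow> nat \<Rightarrow> real \<Rightarrow> complex" where
  "polya_q \<omega> j y = complex_of_real ((minus_D ^^ j) \<omega> y)"

end

theory Submission
  imports Defs
begin

text \<open>
  Write \<open>F\<close> for the Fourier transform of \<open>\<omega>\<close>. Everything rests on two facts about the moments of
  the weights \<open>(- D) ^ m \<omega>\<close> and on Taylor coefficients at \<open>0\<close>.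

  \<^item> Integration by parts (\<open>moment_minus_D\<close>) turns \<open>\<integral> x ^ a (- D) ^ m \<omega>\<close> into \<open>a! / (a - m)!\<close> times the
    moment of order \<open>a - m\<close> of \<open>\<omega>\<close>, and into \<open>0\<close> if \<open>a < m\<close>. The boundary terms vanish because a
    differentiable function that is integrable together with its derivative has a derivative of
    integral \<open>0\<close> (\<open>integral_derivative_eq_0\<close>).
  \<^item> The moments of \<open>\<omega>\<close> are the values at \<open>0\<close> of the derivatives \<open>(- \<i> d/dt) ^ k F\<close>, and the Leibniz
    rule for \<open>F * (1 / F) = 1\<close> says that they are convolution inverse to the derivatives
    \<open>(- \<i> d/dt) ^ k (1 / F)\<close> (\<open>recip_chain_convolution\<close>, \<open>D_chain_recip\<close>).

  Bi-orthonormality follows: expanding \<open>(y - \<i> d/dt) ^ l (1 / F)\<close> by the binomial theorem makes \<open>p\<^sub>l\<close>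
  a polynomial of exact degree \<open>l\<close> whose coefficients are, up to factorials, the derivatives of \<open>1 / F\<close> at
  \<open>0\<close>; its pairing with \<open>q\<^sub>m\<close> collapses, by the first fact, to the convolution of order \<open>l - m\<close> of the second
  (\<open>polya_biorthonormal\<close>).

  The kernel formula is a generating function identity. The powers of \<open>s - (y' - \<i> d/dt) d/dy\<close> expand
  binomially, and integrating against \<open>exp (- s)\<close> replaces \<open>s ^ k\<close> by \<open>k!\<close>, which turns the binomial
  coefficients into the factors \<open>1 / k!\<close> of the \<open>p\<^sub>k\<close> (\<open>polya_kernel\<close>).

  The density of the ensemble is given only up to a constant. The constant is forced by total mass \<open>1\<close>:
  Andreief's identity and the triangular moment matrix evaluate the integral of the Vandermonde
  determinant times the determinant of the weights (\<open>vandermonde_det_integral\<close>), and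
  all eigenvalues of a Hermitian matrix being real, the event that the eigenvalues form a point of
  \<open>\<real> ^ n\<close> has probability \<open>1\<close> (\<open>joint_eigenvalue_density_total\<close>). The same computation shows that
  the integral of \<open>\<omega>\<close>, that is \<open>F 0\<close>, is not \<open>0\<close>, without which \<open>1 / F\<close> would make no sense near \<open>0\<close>.
\<close>

section \<open>Moments of the weights and the Fourier transform\<close>

text \<open>
  The integrability condition on \<open>\<omega>\<close> speaks of \<open>\<bar>x\<bar> powr a\<close>, which differs from \<open>\<bar>x\<bar> ^ a\<close> only at the null
  set \<open>{0}\<close>. Measurability of the top derivative, which need not be continuous, is also contained
  in this condition, after the value at \<open>0\<close> is restored.
\<close>

lemma L1F_moment_integrable:
  assumes w: "\<omega> \<in> L1F n" and "a < n" "j < n"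
  shows "integrable lborel (\<lambda>x. x ^ a * (deriv ^^ j) \<omega> x)"
proof -
  let ?f = "(deriv ^^ j) \<omega>"
  have int: "integrable lborel (\<lambda>x. \<bar>x\<bar> powr (\<kappa> - 1) * ?f x)"
    if "1 \<le> \<kappa>" "\<kappa> \<le> real n" for \<kappa>
    using w that assms(3) unfolding L1F_def by auto
  have "(\<lambda>x. \<bar>x\<bar> powr (1 - 1) * ?f x) \<in> borel_measurable lborel"
    using int[of 1] assms(2) by (intro borel_measurable_integrable) auto
  then have "(\<lambda>x. \<bar>x\<bar> powr (1 - 1) * ?f x + indicator {0} x * ?f 0) \<in> borel_measurable lborel"
    by measurable
  also have "(\<lambda>x. \<bar>x\<bar> powr (1 - 1) * ?f x + indicator {0} x * ?f 0) = ?f"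
    by (auto simp: fun_eq_iff indicator_def)
  finally have meas [measurable]: "?f \<in> borel_measurable lborel" .
  have "integrable lborel (\<lambda>x. \<bar>x\<bar> powr (real (Suc a) - 1) * ?f x)"
    by (rule int) (use assms(2) in auto)
  then show ?thesis
  proof (rule Bochner_Integration.integrable_bound)
    have "AE x in lborel. x \<noteq> (0::real)"
      by (rule AE_lborel_singleton)
    then show "AE x in lborel. norm (x ^ a * ?f x) \<le> norm (\<bar>x\<bar> powr (real (Suc a) - 1) * ?f x)"
      by eventually_elim (simp add: abs_mult powr_realpow power_abs)
  qed measurable
qed

text \<open>
  Integrate \<open>f (x + 1) - f x = \<integral>\<^sub>0\<^sup>1 f' (x + u) du\<close> over all \<open>x\<close>. The left-hand side gives \<open>0\<close> by
  translation invariance, the right-hand side gives \<open>\<integral> f'\<close> by Fubini. This avoids limits of \<open>f\<close> at infinity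
  and continuity of \<open>f'\<close>.
\<close>

lemma integral_derivative_eq_0:
  fixes f f' :: "real \<Rightarrow> real"
  assumes d: "\<And>x. (f has_field_derivative f' x) (at x)"
    and f: "integrable lborel f" and f': "integrable lborel f'"
  shows "(\<integral>x. f' x \<partial>lborel) = 0"
proof -
  let ?h = "\<lambda>u x. indicator {0..1::real} u * f' (x + u)"
  have [measurable]: "f' \<in> borel_measurable borel"
    using f' by (auto dest: borel_measurable_integrable)
  have sh: "integrable lborel (\<lambda>x. g (x + u))" "(\<integral>x. g (x + u) \<partial>lborel) = (\<integral>x. g x \<partial>lborel)"
    if "integrable lborel g" for g :: "real \<Rightarrow> real" and u
    using lborel_integrable_real_affine[OF that, of 1 u]
      lborel_integral_real_affine[of 1 g u] by (simp_all add: add.commute)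
  have "integrable (lborel \<Otimes>\<^sub>M lborel) (case_prod ?h)"
  proof (rule lborel_pair.Fubini_integrable)
    have "integrable lborel (\<lambda>u. indicator {0..1::real} u * (\<integral>x. \<bar>f' x\<bar> \<partial>lborel))"
      by (intro integrable_mult_left integrable_real_indicator) auto
    also have "(\<lambda>u. indicator {0..1::real} u * (\<integral>x. \<bar>f' x\<bar> \<partial>lborel)) =
        (\<lambda>u. \<integral>x. norm (case (u, x) of (u, x) \<Rightarrow> ?h u x) \<partial>lborel)"
      using sh(2)[OF integrable_abs[OF f']] by (auto simp: fun_eq_iff abs_mult)
    finally show "integrable lborel (\<lambda>u. \<integral>x. norm (case (u, x) of (u, x) \<Rightarrow> ?h u x) \<partial>lborel)" .
    show "AE u in lborel. integrable lborel (\<lambda>x. case (u, x) of (u, x) \<Rightarrow> ?h u x)"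
      using sh(1)[OF f'] by auto
  qed measurable
  then have eq: "(\<integral>x. (\<integral>u. ?h u x \<partial>lborel) \<partial>lborel) = (\<integral>u. (\<integral>x. ?h u x \<partial>lborel) \<partial>lborel)"
    by (rule lborel_pair.Fubini_integral)
  have "(\<integral>u. ?h u x \<partial>lborel) = f (x + 1) - f x" for x
  proof -
    have "integrable lborel (\<lambda>u. f' (x + u))"
      using sh(1)[OF f', of x] by (simp add: add.commute)
    then have "set_integrable lborel {0..1} (\<lambda>u. f' (x + u))"
      unfolding set_integrable_def by (intro integrable_mult_indicator) auto
    then have "(LBINT u:{0..1}. f' (x + u)) = integral {0..1} (\<lambda>u. f' (x + u))"
      by (rule set_borel_integral_eq_integral(2))
    moreover have "((\<lambda>u. f' (x + u)) has_integral f (x + 1) - f (x + 0)) {0..1}"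
    proof (rule fundamental_theorem_of_calculus)
      fix u :: real
      have "((\<lambda>u. f (x + u)) has_field_derivative f' (x + u)) (at u)"
        using d[of "u + x"] by (simp add: DERIV_shift add.commute)
      then show "((\<lambda>u. f (x + u)) has_vector_derivative f' (x + u)) (at u within {0..1})"
        by (simp add: has_real_derivative_iff_has_vector_derivative has_vector_derivative_at_within)
    qed simp
    then have "integral {0..1} (\<lambda>u. f' (x + u)) = f (x + 1) - f x"
      by (simp add: integral_unique)
    ultimately show ?thesis
      by (simp add: set_lebesgue_integral_def)
  qed
  then have "(\<integral>x. (\<integral>u. ?h u x \<partial>lborel) \<partial>lborel) = 0"
    using sh[OF f, of 1] f by simp
  moreover have "(\<integral>u. (\<integral>x. ?h u x \<partial>lborel) \<partial>lborel) = (\<integral>x. f' x \<partial>lborel)"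
    using sh(2)[OF f'] by simp
  ultimately show ?thesis using eq by simp
qed

text \<open>
  Pulling the sign out of a derivative needs differentiability, hence the bound on the order.
\<close>

lemma minus_D_eq:
  assumes "\<omega> \<in> L1F n" "j < n"
  shows "(minus_D ^^ j) \<omega> = (\<lambda>x. (- 1) ^ j * (deriv ^^ j) \<omega> x)"
  using assms(2)
proof (induction j)
  case (Suc j)
  have "(deriv ^^ j) \<omega> differentiable (at x)" for x
    using assms(1) Suc.prems by (auto simp: L1F_def)
  then have "(deriv ^^ j) \<omega> field_differentiable (at x)" for x
    by (simp add: real_differentiable_def field_differentiable_def)
  moreover have "(minus_D ^^ Suc j) \<omega> = (\<lambda>x. - deriv (\<lambda>x. (- 1) ^ j * (deriv ^^ j) \<omega> x) x)"
    using Suc by (simp add: minus_D_def[of "\<lambda>x. (- 1) ^ j * (deriv ^^ j) \<omega> x"])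
  ultimately show ?case
    by (simp add: fun_eq_iff)
qed simp

lemma L1F_minus_D_has_derivative:
  assumes "\<omega> \<in> L1F n" "Suc j < n"
  shows "((minus_D ^^ j) \<omega> has_field_derivative - (minus_D ^^ Suc j) \<omega> x) (at x)"
proof -
  have "(deriv ^^ j) \<omega> differentiable (at x)"
    using assms by (auto simp: L1F_def)
  then have "((deriv ^^ j) \<omega> has_field_derivative deriv ((deriv ^^ j) \<omega>) x) (at x)"
    by (meson DERIV_deriv_iff_real_differentiable)
  then show ?thesis
    using minus_D_eq[OF assms(1), of j] minus_D_eq[OF assms] assms(2)
    by (auto intro!: derivative_eq_intros)
qed

lemma L1F_minus_D_moment_integrable:
  assumes "\<omega> \<in> L1F n" "a < n" "j < n"
  shows "integrable lborel (\<lambda>x. x ^ a * (minus_D ^^ j) \<omega> x)"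
  using integrable_mult_right[of "(-1) ^ j", OF L1F_moment_integrable[OF assms]]
  by (simp add: minus_D_eq[OF assms(1,3)] mult_ac)

text \<open>
  Repeated integration by parts. For \<open>m > a\<close> the monomial is differentiated away.
\<close>

lemma moment_minus_D:
  assumes w: "\<omega> \<in> L1F n" and "a < n" "m < n"
  shows "(\<integral>x. x ^ a * (minus_D ^^ m) \<omega> x \<partial>lborel) =
    (if m \<le> a then fact a / fact (a - m) * (\<integral>x. x ^ (a - m) * \<omega> x \<partial>lborel) else 0)"
  using assms(2,3)
proof (induction m arbitrary: a)
  case (Suc m)
  let ?g = "(minus_D ^^ m) \<omega>" and ?g' = "(minus_D ^^ Suc m) \<omega>"
  have g': "integrable lborel (\<lambda>x. x ^ a * ?g' x)"
    using L1F_minus_D_moment_integrable[OF w] Suc.prems by blast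
  have g: "integrable lborel (\<lambda>x. x ^ b * ?g x)" if "b \<le> a" for b
    using L1F_minus_D_moment_integrable[OF w, of b m] Suc.prems that by simp
  have "(\<integral>x. real a * (x ^ (a - 1) * ?g x) - x ^ a * ?g' x \<partial>lborel) = 0"
  proof (rule integral_derivative_eq_0)
    show "((\<lambda>x. x ^ a * ?g x) has_field_derivative
      real a * (x ^ (a - 1) * ?g x) - x ^ a * ?g' x) (at x)" for x
      using L1F_minus_D_has_derivative[OF w Suc.prems(2)]
      by (auto intro!: derivative_eq_intros)
  qed (use g g' in auto)
  then have eq: "(\<integral>x. x ^ a * ?g' x \<partial>lborel) = real a * (\<integral>x. x ^ (a - 1) * ?g x \<partial>lborel)"
    using g g' by simp
  show ?case
  proof (cases a)
    case (Suc b)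
    then show ?thesis
      using eq Suc.IH[of b] Suc.prems by (auto simp: field_simps)
  qed (use eq in simp)
qed simp

lemma has_vector_derivative_iff_tendsto:
  "(f has_vector_derivative D) (at x) \<longleftrightarrow> ((\<lambda>h. (f (x + h) - f x) /\<^sub>R h) \<longlongrightarrow> D) (at 0)"
proof -
  have "norm (f (x + h) - f x - h *\<^sub>R D) / norm h = norm ((f (x + h) - f x) /\<^sub>R h - D)"
    if "h \<noteq> 0" for h
  proof -
    have "(f (x + h) - f x) /\<^sub>R h - D = (f (x + h) - f x - h *\<^sub>R D) /\<^sub>R h"
      using that by (simp add: scaleR_right_diff_distrib)
    then show ?thesis
      by (simp add: divide_inverse mult.commute)
  qed
  then have "((\<lambda>h. norm (f (x + h) - f x - h *\<^sub>R D) / norm h) \<longlongrightarrow> 0) (at 0) \<longleftrightarrow>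
      ((\<lambda>h. norm ((f (x + h) - f x) /\<^sub>R h - D)) \<longlongrightarrow> 0) (at 0)"
    by (intro tendsto_cong) (auto simp: eventually_at_filter)
  also have "\<dots> \<longleftrightarrow> ((\<lambda>h. (f (x + h) - f x) /\<^sub>R h) \<longlongrightarrow> D) (at 0)"
    unfolding tendsto_norm_zero_iff by (rule LIM_zero_iff)
  finally show ?thesis
    by (simp add: has_vector_derivative_def has_derivative_at bounded_linear_scaleR_left)
qed

text \<open>
  Differentiation under the integral sign: the difference quotients of \<open>exp (\<i> x t)\<close> are bounded by
  \<open>\<bar>x\<bar>\<close>, so \<open>\<bar>x f x\<bar>\<close> is an integrable majorant.
\<close>

lemma fourier_has_vector_derivative:
  assumes f: "integrable lborel f" and xf: "integrable lborel (\<lambda>x. x * f x)"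
  shows "(fourier f has_vector_derivative \<i> * fourier (\<lambda>x. x * f x) s) (at s)"
proof -
  have [measurable]: "f \<in> borel_measurable borel"
    using f by (auto dest: borel_measurable_integrable)
  let ?e = "\<lambda>x s. complex_of_real (f x) * iexp (x * s)"
  have int: "integrable lborel (\<lambda>x. ?e x s)" for s
    by (rule Bochner_Integration.integrable_bound[OF f]) (auto simp: norm_mult)
  have ne: "norm (iexp r - 1) \<le> \<bar>r\<bar>" for r
    using iexp_approx1[of r 0] by simp
  have e': "((\<lambda>h. (iexp (x * h) - 1) / complex_of_real h) \<longlongrightarrow> \<i> * complex_of_real x) (at 0)" for x
  proof -
    have "((\<lambda>z. exp (\<i> * complex_of_real x * z)) has_field_derivative \<i> * complex_of_real x)
        (at (complex_of_real 0))"
      by (auto intro!: derivative_eq_intros)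
    then have "((\<lambda>h::real. exp (\<i> * complex_of_real x * complex_of_real h))
        has_vector_derivative \<i> * complex_of_real x) (at 0)"
      by (rule has_vector_derivative_real_field)
    then show ?thesis
      unfolding has_vector_derivative_iff_tendsto
      by (simp add: scaleR_conv_of_real divide_inverse mult_ac)
  qed
  have "((\<lambda>h. (fourier f (s + h) - fourier f s) /\<^sub>R h) \<longlongrightarrow> \<i> * fourier (\<lambda>x. x * f x) s) (at 0)"
    unfolding tendsto_at_iff_sequentially
  proof (safe, unfold comp_def)
    fix X :: "nat \<Rightarrow> real" assume nz: "\<forall>i. X i \<in> UNIV - {0}" and X: "X \<longlonglongrightarrow> 0"
    let ?q = "\<lambda>i x. ?e x s * ((iexp (x * X i) - 1) / complex_of_real (X i))"
    have "(\<lambda>i. \<integral>x. ?q i x \<partial>lborel) \<longlonglongrightarrow>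
      (\<integral>x. ?e x s * (\<i> * complex_of_real x) \<partial>lborel)"
    proof (rule integral_dominated_convergence[where w = "\<lambda>x. \<bar>x * f x\<bar>"])
      show "AE x in lborel. (\<lambda>i. ?q i x) \<longlonglongrightarrow> ?e x s * (\<i> * complex_of_real x)"
      proof (intro AE_I2 tendsto_mult tendsto_const)
        fix x
        have "filterlim X (at 0) sequentially"
          using nz X by (auto simp: filterlim_at)
        then show "(\<lambda>i. (iexp (x * X i) - 1) / complex_of_real (X i)) \<longlonglongrightarrow> \<i> * complex_of_real x"
          by (rule filterlim_compose[OF e'])
      qed
      have "norm (?q i x) \<le> \<bar>x * f x\<bar>" for i x
      proof -
        have "norm ((iexp (x * X i) - 1) / complex_of_real (X i)) \<le> \<bar>x\<bar>"
          using ne[of "x * X i"] nz by (auto simp: norm_divide field_simps abs_mult)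
        then have "\<bar>f x\<bar> * norm ((iexp (x * X i) - 1) / complex_of_real (X i)) \<le> \<bar>f x\<bar> * \<bar>x\<bar>"
          by (rule mult_left_mono) simp
        then show ?thesis
          by (simp add: norm_mult norm_divide abs_mult mult_ac)
      qed
      then show "AE x in lborel. norm (?q i x) \<le> \<bar>x * f x\<bar>" for i
        by simp
    qed (use xf in auto)
    moreover have "(\<integral>x. ?q i x \<partial>lborel) = (fourier f (s + X i) - fourier f s) /\<^sub>R X i" for i
    proof -
      have "fourier f (s + X i) - fourier f s = (\<integral>x. ?e x (s + X i) - ?e x s \<partial>lborel)"
        unfolding fourier_def by (rule Bochner_Integration.integral_diff[symmetric, OF int int])
      then have "(fourier f (s + X i) - fourier f s) /\<^sub>R X i =
        (\<integral>x. (?e x (s + X i) - ?e x s) /\<^sub>R X i \<partial>lborel)"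
        by simp
      also have "\<dots> = (\<integral>x. ?q i x \<partial>lborel)"
        by (rule Bochner_Integration.integral_cong)
          (auto simp: scaleR_conv_of_real divide_inverse algebra_simps exp_add)
      finally show ?thesis by simp
    qed
    moreover have "(\<integral>x. ?e x s * (\<i> * complex_of_real x) \<partial>lborel) = \<i> * fourier (\<lambda>x. x * f x) s"
      unfolding fourier_def by (subst integral_mult_right_zero[symmetric]) (simp add: mult_ac)
    ultimately show "(\<lambda>i. (fourier f (s + X i) - fourier f s) /\<^sub>R X i) \<longlonglongrightarrow> \<i> * fourier (\<lambda>x. x * f x) s"
      by simp
  qed
  then show ?thesis
    by (simp add: has_vector_derivative_iff_tendsto)
qed

section \<open>Derivatives of a reciprocal and powers of the operators\<close>

text \<open>
  Pascal's rule in the form needed for operator powers: it is the induction step of every expansion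
  of the Leibniz or binomial type below.
\<close>

lemma sum_binomial_Suc:
  fixes a b :: "nat \<Rightarrow> 'a::comm_semiring_1"
  shows "(\<Sum>k\<le>Suc r. of_nat (Suc r choose k) * a k * b (Suc r - k)) =
    (\<Sum>k\<le>r. of_nat (r choose k) * (a k * b (Suc (r - k)) + a (Suc k) * b (r - k)))"
proof -
  have "(\<Sum>k\<le>Suc r. of_nat (Suc r choose k) * a k * b (Suc r - k)) =
      a 0 * b (Suc r) + (\<Sum>k\<le>r. of_nat (r choose Suc k) * a (Suc k) * b (r - k))
      + (\<Sum>k\<le>r. of_nat (r choose k) * a (Suc k) * b (r - k))"
    by (subst sum.atMost_Suc_shift) (simp add: sum.distrib algebra_simps)
  also have "a 0 * b (Suc r) + (\<Sum>k\<le>r. of_nat (r choose Suc k) * a (Suc k) * b (r - k)) =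
      (\<Sum>k\<le>Suc r. of_nat (r choose k) * a k * b (Suc r - k))"
    by (subst sum.atMost_Suc_shift) simp
  also have "\<dots> = (\<Sum>k\<le>r. of_nat (r choose k) * a k * b (Suc (r - k)))"
    by (auto intro!: sum.cong simp: Suc_diff_le binomial_eq_0)
  finally show ?thesis
    by (simp add: sum.distrib algebra_simps)
qed

text \<open>
  \<open>g k\<close> is the \<open>k\<close>-th power of \<open>- \<i> d/dt\<close> applied to \<open>g 0\<close>, for \<open>k \<le> N\<close>, on the set \<open>U\<close>. The factor \<open>\<i>\<close>
  makes the chain of a Fourier transform consist of the transforms of \<open>x ^ k f\<close>.
\<close>

definition D_chain :: "real set \<Rightarrow> nat \<Rightarrow> (nat \<Rightarrow> real \<Rightarrow> complex) \<Rightarrow> bool" where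
  "D_chain U N g \<longleftrightarrow> (\<forall>k<N. \<forall>t\<in>U. (g k has_vector_derivative \<i> * g (Suc k) t) (at t))"

lemma D_chain_fourier:
  assumes "\<omega> \<in> L1F n"
  shows "D_chain UNIV (n - 1) (\<lambda>k. fourier (\<lambda>x. x ^ k * \<omega> x))"
  unfolding D_chain_def
proof safe
  fix k t assume "k < n - 1"
  then have "integrable lborel (\<lambda>x. x ^ k * \<omega> x)" "integrable lborel (\<lambda>x. x * (x ^ k * \<omega> x))"
    using L1F_moment_integrable[OF assms, of _ 0] L1F_moment_integrable[OF assms, of "Suc k" 0]
    by (auto simp: mult_ac)
  from fourier_has_vector_derivative[OF this, of t]
  show "(fourier (\<lambda>x. x ^ k * \<omega> x) has_vector_derivative
      \<i> * fourier (\<lambda>x. x ^ Suc k * \<omega> x) t) (at t)"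
    by (simp add: mult_ac)
qed

text \<open>
  The derivatives of \<open>1 / F\<close>, obtained by solving the Leibniz rule for \<open>F * (1 / F) = 1\<close> for the term of
  highest order. The recursion is purely algebraic; that it yields derivatives is \<open>D_chain_recip\<close>.
\<close>

fun recip_chain :: "(nat \<Rightarrow> real \<Rightarrow> complex) \<Rightarrow> nat \<Rightarrow> real \<Rightarrow> complex" where
  "recip_chain F r = (\<lambda>t. if r = 0 then 1 / F 0 t else
     - (\<Sum>k<r. of_nat (r choose k) * recip_chain F k t * F (r - k) t) / F 0 t)"

declare recip_chain.simps [simp del]

lemma recip_chain_0: "recip_chain F 0 = (\<lambda>t. 1 / F 0 t)"
  by (simp add: recip_chain.simps)

lemma recip_chain_convolution:
  assumes "F 0 t \<noteq> 0"
  shows "(\<Sum>k\<le>r. of_nat (r choose k) * recip_chain F k t * F (r - k) t) = (if r = 0 then 1 else 0)"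
  using assms recip_chain.simps[of F r]
  by (cases r) (simp_all add: recip_chain_0 lessThan_Suc_atMost divide_simps)

text \<open>
  The convolution identity for order \<open>r\<close> is constant on \<open>U\<close>. Differentiating it gives, by Pascal's rule,
  a relation that has the same form as the convolution identity for order \<open>r + 1\<close>, with the derivative of
  \<open>recip_chain F r\<close> in the place of \<open>recip_chain F (r + 1)\<close>. Both relations determine that unknown,
  since \<open>F 0\<close> does not vanish.
\<close>

lemma D_chain_recip:
  assumes U: "open U" and F: "D_chain U N F" and nz: "\<And>t. t \<in> U \<Longrightarrow> F 0 t \<noteq> 0"
  shows "D_chain U N (recip_chain F)"
proof -
  let ?G = "recip_chain F"
  have F': "(F k has_vector_derivative \<i> * F (Suc k) t) (at t)" if "k < N" "t \<in> U" for k t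
    using F that by (auto simp: D_chain_def)
  have "(?G r has_vector_derivative \<i> * ?G (Suc r) t) (at t)" if "r < N" "t \<in> U" for r t
    using that(1)
  proof (induction r rule: less_induct)
    case (less r)
    note t = \<open>t \<in> U\<close>
    have G': "(?G k has_vector_derivative \<i> * ?G (Suc k) t) (at t)" if "k < r" for k
      using less.IH[of k] that less.prems by simp
    have Fd: "F k differentiable (at t)" if "k < N" for k
      using F'[OF that t] by (rule differentiableI_vector)
    have Gd: "?G k differentiable (at t)" if "k < r" for k
      using G'[OF that] by (rule differentiableI_vector)
    have "?G r differentiable (at t)"
    proof (cases "r = 0")
      case True
      then show ?thesis
        using Fd[of 0] nz[OF t] less.prems
        by (auto simp: recip_chain_0 intro!: differentiable_divide)
    next
      case False
      have "(\<lambda>t. - (\<Sum>k<r. of_nat (r choose k) * ?G k t * F (r - k) t) / F 0 t)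
          differentiable (at t)"
        by (intro differentiable_divide differentiable_minus differentiable_sum ballI
            differentiable_mult differentiable_const Fd Gd nz t) (use less.prems False in auto)
      then show ?thesis
        using False by (subst recip_chain.simps) simp
    qed
    then obtain D where D: "(?G r has_vector_derivative D) (at t)"
      by (auto simp: vector_derivative_works)
    \<comment> \<open>The derivative of order \<open>r\<close>, about which only existence is known so far, is kept as \<open>D\<close>.\<close>
    define G1 where "G1 k = (if k = r then D else \<i> * ?G (Suc k) t)" for k
    have G1: "(?G k has_vector_derivative G1 k) (at t)" if "k \<le> r" for k
      using that D G' by (auto simp: G1_def)
    let ?S = "\<lambda>\<tau>. \<Sum>k\<le>r. of_nat (r choose k) * (?G k \<tau> * F (r - k) \<tau>)"
    have "(?S has_vector_derivative
      (\<Sum>k\<le>r. of_nat (r choose k) * (?G k t * (\<i> * F (Suc (r - k)) t) + G1 k * F (r - k) t))) (at t)"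
      by (intro has_vector_derivative_sum has_vector_derivative_mult_right
          has_vector_derivative_mult G1 F' t) (use less.prems in auto)
    moreover have "(?S has_vector_derivative 0) (at t)"
    proof (rule has_vector_derivative_transform_within_open[OF _ U t])
      show "((\<lambda>_. if r = 0 then 1 else 0) has_vector_derivative 0) (at t)"
        by (rule has_vector_derivative_const)
      show "(if r = 0 then 1 else 0) = ?S \<tau>" if "\<tau> \<in> U" for \<tau>
        using recip_chain_convolution[where F = F and t = \<tau> and r = r] nz[OF that]
        by (simp only: mult.assoc) simp
    qed
    ultimately have "(\<Sum>k\<le>r. of_nat (r choose k) *
        (?G k t * (\<i> * F (Suc (r - k)) t) + G1 k * F (r - k) t)) = 0"
      by (rule vector_derivative_unique_at)
    moreover have "(\<Sum>k\<le>r. of_nat (r choose k) *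
        (?G k t * (\<i> * F (Suc (r - k)) t) + \<i> * ?G (Suc k) t * F (r - k) t)) = 0"
    proof -
      have "(\<Sum>k\<le>r. of_nat (r choose k) *
          (?G k t * F (Suc (r - k)) t + ?G (Suc k) t * F (r - k) t)) = 0"
        using recip_chain_convolution[of F t "Suc r"] nz[OF t]
        by (simp only: sum_binomial_Suc[of r "\<lambda>k. ?G k t" "\<lambda>k. F k t"]) simp
      then have "\<i> * (\<Sum>k\<le>r. of_nat (r choose k) *
          (?G k t * F (Suc (r - k)) t + ?G (Suc k) t * F (r - k) t)) = 0"
        by simp
      also have "\<i> * (\<Sum>k\<le>r. of_nat (r choose k) *
          (?G k t * F (Suc (r - k)) t + ?G (Suc k) t * F (r - k) t)) =
        (\<Sum>k\<le>r. of_nat (r choose k) *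
          (?G k t * (\<i> * F (Suc (r - k)) t) + \<i> * ?G (Suc k) t * F (r - k) t))"
        unfolding sum_distrib_left by (intro sum.cong refl) (simp add: algebra_simps)
      finally show ?thesis .
    qed
    ultimately have "0 = (\<Sum>k\<le>r. of_nat (r choose k) *
        (?G k t * (\<i> * F (Suc (r - k)) t) + G1 k * F (r - k) t)) -
        (\<Sum>k\<le>r. of_nat (r choose k) *
        (?G k t * (\<i> * F (Suc (r - k)) t) + \<i> * ?G (Suc k) t * F (r - k) t))"
      by (simp only: diff_zero)
    also have "\<dots> = (\<Sum>k\<le>r. if k = r then (D - \<i> * ?G (Suc r) t) * F 0 t else 0)"
      unfolding sum_subtractf[symmetric]
      by (intro sum.cong) (auto simp: G1_def algebra_simps)
    finally have "D = \<i> * ?G (Suc r) t"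
      using nz[OF t] by simp
    then show ?case using D by simp
  qed
  then show ?thesis by (auto simp: D_chain_def)
qed

text \<open>
  The binomial expansion of \<open>(y - \<i> d/dt) ^ j\<close> applied to \<open>g 0\<close>.
\<close>

definition shifted_power :: "real \<Rightarrow> (nat \<Rightarrow> real \<Rightarrow> complex) \<Rightarrow> nat \<Rightarrow> real \<Rightarrow> complex" where
  "shifted_power y g j t = (\<Sum>k\<le>j. of_nat (j choose k) * g k t * complex_of_real y ^ (j - k))"

lemma shifted_power_0 [simp]: "shifted_power y g 0 = g 0"
  by (simp add: shifted_power_def fun_eq_iff)

text \<open>
  This says that \<open>y - \<i> d/dt\<close> maps \<open>shifted_power y g j\<close> to \<open>shifted_power y g (j + 1)\<close>.
\<close>

lemma shifted_power_has_vector_derivative: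
  assumes g: "D_chain U N g" and "j < N" "t \<in> U"
  shows "(shifted_power y g j has_vector_derivative
    \<i> * (shifted_power y g (Suc j) t - y * shifted_power y g j t)) (at t)"
proof -
  have eq: "shifted_power y g (Suc j) t - y * shifted_power y g j t =
    (\<Sum>k\<le>j. of_nat (j choose k) * g (Suc k) t * complex_of_real y ^ (j - k))"
    unfolding shifted_power_def sum_binomial_Suc[of j "\<lambda>k. g k t" "\<lambda>m. complex_of_real y ^ m"]
    by (simp add: sum_distrib_left sum.distrib algebra_simps)
  have "\<i> * (shifted_power y g (Suc j) t - y * shifted_power y g j t) =
      (\<Sum>k\<le>j. of_nat (j choose k) * (\<i> * g (Suc k) t) * complex_of_real y ^ (j - k))"
    unfolding eq sum_distrib_left by (intro sum.cong refl) (simp add: mult_ac)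
  moreover have "((\<lambda>t. shifted_power y g j t) has_vector_derivative
      (\<Sum>k\<le>j. of_nat (j choose k) * (\<i> * g (Suc k) t) * complex_of_real y ^ (j - k))) (at t)"
    unfolding shifted_power_def
    by (intro has_vector_derivative_sum has_vector_derivative_mult_right has_vector_derivative_mult_left)
      (use assms in \<open>auto simp: D_chain_def\<close>)
  ultimately show ?thesis by simp
qed

text \<open>
  \<open>U\<close> has to be open because each iterate is known only on \<open>U\<close> and is then differentiated.
\<close>

lemma param_minus_iD_iterate:
  assumes U: "open U" and g: "D_chain U N g"
  shows "j \<le> N \<Longrightarrow> t \<in> U \<Longrightarrow> (param_minus_iD y ^^ j) (g 0) t = shifted_power y g j t"
proof (induction j arbitrary: t)
  case (Suc j)
  have "((param_minus_iD y ^^ j) (g 0) has_vector_derivative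
      \<i> * (shifted_power y g (Suc j) t - y * shifted_power y g j t)) (at t)"
  proof (rule has_vector_derivative_transform_within_open[OF _ U Suc.prems(2)])
    show "(shifted_power y g j has_vector_derivative
        \<i> * (shifted_power y g (Suc j) t - y * shifted_power y g j t)) (at t)"
      by (rule shifted_power_has_vector_derivative[OF g]) (use Suc.prems in auto)
    show "shifted_power y g j \<tau> = (param_minus_iD y ^^ j) (g 0) \<tau>" if "\<tau> \<in> U" for \<tau>
      by (rule Suc.IH[symmetric]) (use Suc.prems that in auto)
  qed
  then have d: "vector_derivative ((param_minus_iD y ^^ j) (g 0)) (at t) =
      \<i> * (shifted_power y g (Suc j) t - y * shifted_power y g j t)"
    by (rule vector_derivative_at)
  have eq: "(param_minus_iD y ^^ j) (g 0) t = shifted_power y g j t"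
    by (rule Suc.IH) (use Suc.prems in auto)
  have "(param_minus_iD y ^^ Suc j) (g 0) t =
      y * shifted_power y g j t - \<i> * (\<i> * (shifted_power y g (Suc j) t - y * shifted_power y g j t))"
    by (simp only: funpow.simps comp_apply param_minus_iD_def[of y "(param_minus_iD y ^^ j) (g 0)"] d eq)
  then show ?case
    by (simp only: flip: mult.assoc) simp
qed simp

text \<open>
  The two minus signs, of the operator and of the derivative of \<open>q k\<close>, cancel in every step.
\<close>

lemma kernel_operator_iterate:
  assumes U: "open U" and g: "D_chain U N g"
    and q: "\<And>k y. k < N \<Longrightarrow> (q k has_field_derivative - q (Suc k) y) (at y)"
  shows "j \<le> N \<Longrightarrow> t \<in> U \<Longrightarrow>
    (kernel_operator s y' ^^ j) (\<lambda>t y. complex_of_real (q 0 y) * g 0 t) t y =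
    (\<Sum>k\<le>j. of_nat (j choose k) * (shifted_power y' g k t * complex_of_real (q k y))
      * complex_of_real s ^ (j - k))"
proof (induction j arbitrary: t y)
  case (Suc j)
  let ?P = "shifted_power y' g"
  let ?F = "(kernel_operator s y' ^^ j) (\<lambda>t y. complex_of_real (q 0 y) * g 0 t)"
  let ?V = "\<lambda>\<tau>. - (\<Sum>k\<le>j. of_nat (j choose k) * (?P k \<tau> * complex_of_real (q (Suc k) y))
      * complex_of_real s ^ (j - k))"
  have F: "?F \<tau> = (\<lambda>y. \<Sum>k\<le>j. of_nat (j choose k) * (?P k \<tau> * complex_of_real (q k y))
      * complex_of_real s ^ (j - k))" if "\<tau> \<in> U" for \<tau>
    by (intro ext Suc.IH that) (use Suc.prems in simp)
  have q': "((\<lambda>y. complex_of_real (q k y)) has_vector_derivative - complex_of_real (q (Suc k) y)) (at y)"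
    if "k \<le> j" for k
    using has_vector_derivative_of_real[of "q k" "- q (Suc k) y" "at y"] q[of k y] that Suc.prems
    by (simp add: has_real_derivative_iff_has_vector_derivative)
  have V: "vector_derivative (?F \<tau>) (at y) = ?V \<tau>" if "\<tau> \<in> U" for \<tau>
  proof (rule vector_derivative_at)
    have "((\<lambda>y. \<Sum>k\<le>j. of_nat (j choose k) * (?P k \<tau> * complex_of_real (q k y))
      * complex_of_real s ^ (j - k)) has_vector_derivative
      (\<Sum>k\<le>j. of_nat (j choose k) * (?P k \<tau> * - complex_of_real (q (Suc k) y))
      * complex_of_real s ^ (j - k))) (at y)"
      by (intro has_vector_derivative_sum has_vector_derivative_mult_right
          has_vector_derivative_mult_left q') auto
    then show "(?F \<tau> has_vector_derivative ?V \<tau>) (at y)"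
      unfolding F[OF that] by (simp add: sum_negf)
  qed
  let ?V' = "- (\<Sum>k\<le>j. of_nat (j choose k) *
      (\<i> * (?P (Suc k) t - y' * ?P k t) * complex_of_real (q (Suc k) y)) * complex_of_real s ^ (j - k))"
  have "(?V has_vector_derivative ?V') (at t)"
    by (intro has_vector_derivative_minus has_vector_derivative_sum has_vector_derivative_mult_right
          has_vector_derivative_mult_left shifted_power_has_vector_derivative[OF g])
      (use Suc.prems in auto)
  then have "((\<lambda>\<tau>. vector_derivative (?F \<tau>) (at y)) has_vector_derivative ?V') (at t)"
    by (rule has_vector_derivative_transform_within_open[OF _ U Suc.prems(2)]) (simp add: V)
  then have dV: "vector_derivative (\<lambda>\<tau>. vector_derivative (?F \<tau>) (at y)) (at t) = ?V'"
    by (rule vector_derivative_at)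
  have "(kernel_operator s y' ^^ Suc j) (\<lambda>t y. complex_of_real (q 0 y) * g 0 t) t y =
      s * ?F t y - (y' * vector_derivative (?F t) (at y) -
        \<i> * vector_derivative (\<lambda>\<tau>. vector_derivative (?F \<tau>) (at y)) (at t))"
    by (simp only: funpow.simps comp_apply kernel_operator_def[of s y' ?F] param_minus_iD_def)
  also have "\<dots> = s * ?F t y - (y' * ?V t - \<i> * ?V')"
    by (simp only: dV V[OF Suc.prems(2)])
  also have "y' * ?V t - \<i> * ?V' = - (\<Sum>k\<le>j. of_nat (j choose k) *
      (?P (Suc k) t * complex_of_real (q (Suc k) y)) * complex_of_real s ^ (j - k))"
    unfolding sum_distrib_left sum_subtractf[symmetric] sum_negf[symmetric]
    by (intro sum.cong refl) (simp add: algebra_simps)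
  also have "s * ?F t y - - (\<Sum>k\<le>j. of_nat (j choose k) *
      (?P (Suc k) t * complex_of_real (q (Suc k) y)) * complex_of_real s ^ (j - k)) =
    (\<Sum>k\<le>j. of_nat (j choose k) *
      (?P k t * complex_of_real (q k y) * complex_of_real s ^ Suc (j - k) +
       ?P (Suc k) t * complex_of_real (q (Suc k) y) * complex_of_real s ^ (j - k)))"
    unfolding F[OF Suc.prems(2)] diff_minus_eq_add sum_distrib_left sum.distrib[symmetric]
    by (intro sum.cong refl) (simp add: algebra_simps)
  finally show ?case
    unfolding sum_binomial_Suc[of j "\<lambda>k. ?P k t * complex_of_real (q k y)" "\<lambda>m. complex_of_real s ^ m"] .
qed simp

section \<open>Triangular systems of functions\<close>

lemma complex_lin_spanI: "g = (\<lambda>x. \<Sum>j<n. c j * f j x) \<Longrightarrow> g \<in> complex_lin_span n f"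
  by (auto simp: complex_lin_span_def)

lemma complex_lin_spanE:
  assumes "g \<in> complex_lin_span n f"
  obtains c where "g = (\<lambda>x. \<Sum>j<n. c j * f j x)"
  using assms by (auto simp: complex_lin_span_def)

lemma complex_lin_span_SucI:
  assumes "h \<in> complex_lin_span n f" "g = (\<lambda>x. h x + (\<Sum>j<n. b j * f j x) + c * f n x)"
  shows "g \<in> complex_lin_span (Suc n) f"
proof -
  obtain d where "h = (\<lambda>x. \<Sum>j<n. d j * f j x)"
    using assms(1) by (rule complex_lin_spanE)
  then show ?thesis
    using assms(2)
    by (intro complex_lin_spanI[of _ "\<lambda>j. if j = n then c else d j + b j"])
      (auto simp: fun_eq_iff sum.distrib algebra_simps intro!: sum.cong)
qed

lemma complex_lin_span_SucE:
  assumes "g \<in> complex_lin_span (Suc n) f"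
  obtains h c where "h \<in> complex_lin_span n f" "g = (\<lambda>x. h x + c * f n x)"
proof -
  obtain d where "g = (\<lambda>x. \<Sum>j<Suc n. d j * f j x)"
    using assms by (rule complex_lin_spanE)
  then have "g = (\<lambda>x. (\<Sum>j<n. d j * f j x) + d n * f n x)" by simp
  then show thesis
    by (rule that[OF complex_lin_spanI[OF refl]])
qed

text \<open>
  A triangular change of basis with nonzero diagonal preserves spans.
\<close>

lemma complex_lin_span_triangular:
  assumes "\<And>j. j < n \<Longrightarrow> p j = (\<lambda>x. \<Sum>k\<le>j. a j k * f k x)"
    and "\<And>j. j < n \<Longrightarrow> a j j \<noteq> 0"
  shows "complex_lin_span n p = complex_lin_span n f"
  using assms
proof (induction n)
  case (Suc n)
  then have IH: "complex_lin_span n p = complex_lin_span n f" by simp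
  have p: "p n = (\<lambda>x. (\<Sum>k<n. a n k * f k x) + a n n * f n x)"
    using Suc.prems(1)[of n] by (simp flip: lessThan_Suc_atMost)
  have nz: "a n n \<noteq> 0" using Suc.prems(2) by simp
  show ?case
  proof (intro equalityI subsetI)
    fix g assume "g \<in> complex_lin_span (Suc n) p"
    then obtain h c where h: "h \<in> complex_lin_span n p" and g: "g = (\<lambda>x. h x + c * p n x)"
      by (rule complex_lin_span_SucE)
    show "g \<in> complex_lin_span (Suc n) f"
      by (rule complex_lin_span_SucI[of h _ _ _ "\<lambda>k. c * a n k" "c * a n n"])
        (use h in \<open>simp_all add: IH g p sum_distrib_left algebra_simps\<close>)
  next
    fix g assume "g \<in> complex_lin_span (Suc n) f"
    then obtain h c where h: "h \<in> complex_lin_span n f" and g: "g = (\<lambda>x. h x + c * f n x)"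
      by (rule complex_lin_span_SucE)
    have "(\<lambda>x. h x + (\<Sum>k<n. (- (c / a n n) * a n k) * f k x)) \<in> complex_lin_span n f"
    proof -
      obtain d where "h = (\<lambda>x. \<Sum>j<n. d j * f j x)"
        using h by (rule complex_lin_spanE)
      then show ?thesis
        by (intro complex_lin_spanI[of _ "\<lambda>j. d j + - (c / a n n) * a n j"])
          (simp add: fun_eq_iff sum.distrib[symmetric] algebra_simps)
    qed
    then have "(\<lambda>x. h x - (c / a n n) * (\<Sum>k<n. a n k * f k x)) \<in> complex_lin_span n p"
      by (simp add: IH sum_distrib_left sum_negf mult.assoc)
    then show "g \<in> complex_lin_span (Suc n) p"
      by (rule complex_lin_span_SucI[of _ _ _ _ "\<lambda>k. 0" "c / a n n"])
        (use nz in \<open>simp add: g p fun_eq_iff field_simps\<close>)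
  qed
qed (simp add: complex_lin_span_def)

section \<open>The bi-orthonormal functions and their kernel\<close>

abbreviation fourier_chain :: "(real \<Rightarrow> real) \<Rightarrow> nat \<Rightarrow> real \<Rightarrow> complex" where
  "fourier_chain \<omega> k \<equiv> fourier (\<lambda>x. x ^ k * \<omega> x)"

abbreviation recip_fourier_chain :: "(real \<Rightarrow> real) \<Rightarrow> nat \<Rightarrow> real \<Rightarrow> complex" where
  "recip_fourier_chain \<omega> \<equiv> recip_chain (fourier_chain \<omega>)"

lemma fourier_at_0: "fourier f 0 = complex_of_real (\<integral>x. f x \<partial>lborel)"
  by (simp add: fourier_def)

lemma recip_fourier_chain_0: "recip_fourier_chain \<omega> 0 = (\<lambda>t. 1 / fourier \<omega> t)"
  by (simp add: recip_chain_0)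

text \<open>
  The transform is nonzero on a neighbourhood of \<open>0\<close> by continuity. For \<open>n = 1\<close> the condition on
  derivatives is void, and any neighbourhood will do.
\<close>

lemma D_chain_recip_fourier:
  assumes w: "\<omega> \<in> L1F n" and nz: "fourier \<omega> 0 \<noteq> 0"
  obtains U where "open U" "0 \<in> U" "D_chain U (n - 1) (recip_fourier_chain \<omega>)"
proof (cases "n - 1 = 0")
  case True
  then show thesis
    using that[of UNIV] by (simp add: D_chain_def)
next
  case False
  define U where "U = fourier \<omega> -` (- {0})"
  have chain: "D_chain UNIV (n - 1) (fourier_chain \<omega>)"
    by (rule D_chain_fourier[OF w])
  have "(fourier_chain \<omega> 0 has_vector_derivative \<i> * fourier_chain \<omega> (Suc 0) t) (at t)" for t
    using chain False unfolding D_chain_def by blast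
  then have "continuous (at t) (fourier_chain \<omega> 0)" for t
    by (rule has_vector_derivative_continuous)
  then have "continuous_on UNIV (fourier \<omega>)"
    by (simp add: continuous_on_eq_continuous_at)
  then have "open U"
    unfolding U_def by (intro open_vimage) auto
  moreover have "D_chain U (n - 1) (recip_fourier_chain \<omega>)"
  proof (rule D_chain_recip[OF \<open>open U\<close>])
    show "D_chain U (n - 1) (fourier_chain \<omega>)"
      using chain by (auto simp: D_chain_def)
  qed (simp add: U_def)
  ultimately show thesis
    using that[of U] nz by (simp add: U_def)
qed

lemma polya_p_eq:
  assumes w: "\<omega> \<in> L1F n" and nz: "fourier \<omega> 0 \<noteq> 0" and "j < n"
  shows "polya_p \<omega> j y = shifted_power y (recip_fourier_chain \<omega>) j 0 / fact j"
proof -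
  obtain U where "open U" "0 \<in> U" "D_chain U (n - 1) (recip_fourier_chain \<omega>)"
    using D_chain_recip_fourier[OF w nz] .
  then have "(param_minus_iD y ^^ j) (recip_fourier_chain \<omega> 0) 0 =
      shifted_power y (recip_fourier_chain \<omega>) j 0"
    using assms(3) by (intro param_minus_iD_iterate) auto
  then show ?thesis
    by (simp add: polya_p_def recip_fourier_chain_0)
qed

text \<open>
  The leading coefficient of \<open>polya_p \<omega> j\<close> is \<open>1 / (j! F 0)\<close>, where \<open>F\<close> is the transform of \<open>\<omega>\<close>.
\<close>

lemma polya_p_span:
  assumes w: "\<omega> \<in> L1F n" and nz: "fourier \<omega> 0 \<noteq> 0"
  shows "complex_lin_span n (polya_p \<omega>) = complex_lin_span n (\<lambda>j x. complex_of_real x ^ j)"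
proof -
  let ?G = "\<lambda>k. recip_fourier_chain \<omega> k 0"
  let ?a = "\<lambda>j k. of_nat (j choose k) * ?G (j - k) / fact j"
  have "polya_p \<omega> j x = (\<Sum>k\<le>j. ?a j k * complex_of_real x ^ k)" if "j < n" for j x
  proof -
    have "polya_p \<omega> j x = (\<Sum>k\<le>j. of_nat (j choose k) * ?G k * complex_of_real x ^ (j - k) / fact j)"
      unfolding polya_p_eq[OF w nz that] by (simp add: shifted_power_def sum_divide_distrib)
    also have "\<dots> = (\<Sum>k\<le>j. of_nat (j choose (j - k)) * ?G (j - k) * complex_of_real x ^ k / fact j)"
      by (rule sum.reindex_bij_witness[of _ "\<lambda>k. j - k" "\<lambda>k. j - k"]) auto
    finally show ?thesis
      by (simp add: binomial_symmetric[symmetric])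
  qed
  then show ?thesis
    by (intro complex_lin_span_triangular[where a = ?a] ext)
      (use nz in \<open>auto simp: recip_fourier_chain_0\<close>)
qed

text \<open>
  After the moments are inserted, the factorials combine to the binomial coefficients of order \<open>l - m\<close>,
  and the sum is the convolution of the derivatives of \<open>F\<close> and \<open>1 / F\<close> at \<open>0\<close>.
\<close>

lemma polya_biorthonormal:
  assumes w: "\<omega> \<in> L1F n" and nz: "fourier \<omega> 0 \<noteq> 0" and lm: "l < n" "m < n"
  shows "has_bochner_integral lborel (\<lambda>x. polya_p \<omega> l x * polya_q \<omega> m x) (if l = m then 1 else 0)"
proof -
  let ?G = "\<lambda>k. recip_fourier_chain \<omega> k 0" and ?F = "\<lambda>k. fourier_chain \<omega> k 0"
  let ?c = "\<lambda>k. of_nat (l choose k) * ?G k / fact l"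
  define I where "I a = (\<integral>x. x ^ a * (minus_D ^^ m) \<omega> x \<partial>lborel)" for a
  have I: "complex_of_real (I a) = (if m \<le> a then fact a / fact (a - m) * ?F (a - m) else 0)"
    if "a < n" for a
    using moment_minus_D[OF w that lm(2)] by (simp add: I_def fourier_at_0)
  have "has_bochner_integral lborel
      (\<lambda>x. \<Sum>k\<le>l. ?c k * complex_of_real (x ^ (l - k) * (minus_D ^^ m) \<omega> x))
      (\<Sum>k\<le>l. ?c k * complex_of_real (I (l - k)))"
    unfolding I_def
    by (intro has_bochner_integral_sum has_bochner_integral_mult_right has_bochner_integral_of_real
        has_bochner_integral_integrable L1F_minus_D_moment_integrable[OF w]) (use lm in auto)
  also have "(\<lambda>x. \<Sum>k\<le>l. ?c k * complex_of_real (x ^ (l - k) * (minus_D ^^ m) \<omega> x)) =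
      (\<lambda>x. polya_p \<omega> l x * polya_q \<omega> m x)"
    unfolding polya_p_eq[OF w nz lm(1)] polya_q_def shifted_power_def sum_divide_distrib sum_distrib_right
    by (intro ext sum.cong refl) simp
  also have "(\<Sum>k\<le>l. ?c k * complex_of_real (I (l - k))) = (if l = m then 1 else 0)"
  proof (cases "m \<le> l")
    case True
    have "(\<Sum>k\<le>l. ?c k * complex_of_real (I (l - k))) =
        (\<Sum>k\<le>l - m. ?c k * complex_of_real (I (l - k)))"
      by (rule sum.mono_neutral_right) (use lm I in auto)
    also have "\<dots> = (\<Sum>k\<le>l - m. of_nat (l - m choose k) * ?G k * ?F (l - m - k) / fact (l - m))"
    proof (intro sum.cong refl)
      fix k assume "k \<in> {..l - m}"
      then have k: "k \<le> l - m" "k \<le> l" "m \<le> l - k"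
        using True by auto
      have "?c k * complex_of_real (I (l - k)) =
          of_nat (l choose k) * fact (l - k) / fact l / fact (l - k - m) * ?G k * ?F (l - m - k)"
        using I[of "l - k"] k lm by (simp add: add.commute)
      also have "of_nat (l choose k) * fact (l - k) / fact l / fact (l - k - m) =
          of_nat (l - m choose k) / (fact (l - m) :: complex)"
        using k by (simp add: binomial_fact add.commute)
      finally show "?c k * complex_of_real (I (l - k)) =
          of_nat (l - m choose k) * ?G k * ?F (l - m - k) / fact (l - m)"
        by simp
    qed
    also have "\<dots> = (if l - m = 0 then 1 else 0) / fact (l - m)"
      using recip_chain_convolution[where F = "fourier_chain \<omega>" and t = 0 and r = "l - m"] nz
      by (simp flip: sum_divide_distrib)
    finally show ?thesis
      using True by simp
  next
    case False
    have "(\<Sum>k\<le>l. ?c k * complex_of_real (I (l - k))) = 0"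
      by (rule sum.neutral) (use lm I False in auto)
    then show ?thesis
      using False by auto
  qed
  finally show ?thesis .
qed

text \<open>
  Since \<open>\<integral>\<^sub>0\<^sup>\<infinity> s ^ (n - 1 - k) exp (- s) ds = (n - 1 - k)!\<close>, the binomial coefficient of the \<open>k\<close>-th term
  becomes \<open>(n - 1)! / k!\<close>.
\<close>

lemma polya_kernel:
  assumes n: "n \<ge> 1" and w: "\<omega> \<in> L1F n" and nz: "fourier \<omega> 0 \<noteq> 0"
  shows "has_bochner_integral lborel
    (\<lambda>s. indicator {0..} s *\<^sub>R (complex_of_real (exp (- s)) *
      (kernel_operator s y' ^^ (n - 1)) (\<lambda>t y. complex_of_real (\<omega> y) / fourier \<omega> t) 0 y))
    (fact (n - 1) * biorthonormal_kernel n (polya_p \<omega>) (polya_q \<omega>) y' y)"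
proof -
  let ?G = "recip_fourier_chain \<omega>"
  define c where "c k = of_nat (n - 1 choose k) *
    (shifted_power y' ?G k 0 * complex_of_real ((minus_D ^^ k) \<omega> y))" for k
  obtain U where U: "open U" "0 \<in> U" "D_chain U (n - 1) ?G"
    using D_chain_recip_fourier[OF w nz] .
  have "(kernel_operator s y' ^^ (n - 1)) (\<lambda>t y. complex_of_real ((minus_D ^^ 0) \<omega> y) * ?G 0 t) 0 y =
      (\<Sum>k\<le>n - 1. c k * complex_of_real s ^ (n - 1 - k))" for s
    unfolding c_def
    by (rule kernel_operator_iterate[OF U(1,3), where q = "\<lambda>k. (minus_D ^^ k) \<omega>"])
      (use U(2) L1F_minus_D_has_derivative[OF w] in auto)
  then have "(kernel_operator s y' ^^ (n - 1)) (\<lambda>t y. complex_of_real (\<omega> y) / fourier \<omega> t) 0 y =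
      (\<Sum>k\<le>n - 1. c k * complex_of_real s ^ (n - 1 - k))" for s
    by (simp add: recip_fourier_chain_0)
  then have "(\<lambda>s. indicator {0..} s *\<^sub>R (complex_of_real (exp (- s)) *
      (kernel_operator s y' ^^ (n - 1)) (\<lambda>t y. complex_of_real (\<omega> y) / fourier \<omega> t) 0 y)) =
    (\<lambda>s. \<Sum>k\<le>n - 1. c k * complex_of_real (s ^ (n - 1 - k) * exp (- s) * indicator {0..} s))"
    by (simp add: fun_eq_iff sum_distrib_left scaleR_conv_of_real mult_ac)
  moreover have "has_bochner_integral lborel
      (\<lambda>s. \<Sum>k\<le>n - 1. c k * complex_of_real (s ^ (n - 1 - k) * exp (- s) * indicator {0..} s))
      (\<Sum>k\<le>n - 1. c k * complex_of_real (fact (n - 1 - k)))"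
    by (intro has_bochner_integral_sum has_bochner_integral_mult_right has_bochner_integral_of_real
        has_bochner_integral_I0i_power_exp_m')
  moreover have "(\<Sum>k\<le>n - 1. c k * complex_of_real (fact (n - 1 - k))) =
      fact (n - 1) * biorthonormal_kernel n (polya_p \<omega>) (polya_q \<omega>) y' y"
  proof -
    have "{..n - 1} = {..<n}"
      using n by auto
    moreover have "c k * complex_of_real (fact (n - 1 - k)) =
        fact (n - 1) * (polya_p \<omega> k y' * polya_q \<omega> k y)" if "k < n" for k
    proof -
      have "of_nat (n - 1 choose k) * complex_of_real (fact (n - 1 - k)) = fact (n - 1) / fact k"
        using that by (simp add: binomial_fact)
      then show ?thesis
        unfolding c_def polya_p_eq[OF w nz that] polya_q_def by (simp add: field_simps)
    qed
    ultimately show ?thesis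
      unfolding biorthonormal_kernel_def sum_distrib_left by (intro sum.cong) auto
  qed
  ultimately show ?thesis by simp
qed

section \<open>Determinants, eigenvalues and normalisation\<close>

text \<open>
  The classical argument: as a polynomial in the last node, the determinant has degree at most \<open>n\<close>, its
  leading coefficient is the Vandermonde determinant of the other nodes by Laplace expansion, and it
  vanishes at each of these nodes since two rows coincide. If the other nodes are not distinct, both
  sides are \<open>0\<close>.
\<close>

lemma det_power_matrix:
  "Determinant.det (mat n n (\<lambda>(a, b). x a ^ b)) = vandermonde n x"
proof (induction n)
  case 0
  show ?case
    by (simp add: vandermonde_def)
next
  case (Suc n)
  \<comment> \<open>The power matrix whose last node is the variable \<open>t\<close>.\<close>
  define A where "A t = mat (Suc n) (Suc n) (\<lambda>(a, b). if a = n then t ^ b else x a ^ b)" for t :: real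
  define c where "c j = cofactor (A 0) n j" for j
  define P where "P = (\<Sum>j\<le>n. Polynomial.monom (c j) j)"
  define Q where "Q = Polynomial.smult (vandermonde n x) (\<Prod>i<n. [:- x i, 1:])"
  have A: "A t \<in> carrier_mat (Suc n) (Suc n)" for t
    by (simp add: A_def)
  have cof: "cofactor (A t) n j = c j" if "j \<le> n" for t j
    unfolding c_def cofactor_def
    by (intro arg_cong2[where f = "(*)"] refl arg_cong[where f = Determinant.det] eq_matI)
      (use that in \<open>auto simp: A_def mat_delete_def\<close>)
  have P: "poly P t = Determinant.det (A t)" for t
  proof -
    have "Determinant.det (A t) = (\<Sum>j<Suc n. A t $$ (n, j) * cofactor (A t) n j)"
      by (rule laplace_expansion_row[OF A]) simp
    also have "\<dots> = (\<Sum>j\<le>n. t ^ j * c j)"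
      unfolding lessThan_Suc_atMost
      by (intro sum.cong arg_cong2[where f = "(*)"] cof refl) (auto simp: A_def)
    finally show ?thesis
      by (simp add: P_def poly_sum Polynomial.poly_monom mult.commute)
  qed
  have "mat_delete (A 0) n n = mat n n (\<lambda>(a, b). x a ^ b)"
    by (rule eq_matI) (auto simp: A_def mat_delete_def)
  then have cn: "c n = vandermonde n x"
    by (simp add: c_def cofactor_def Suc.IH)
  have dbl: "poly P t = 0" if ij: "i < j" "j \<le> n" and eq: "x i = (if j = n then t else x j)" for t i j
    unfolding P
  proof (rule det_identical_rows[OF A, of i j])
    show "row (A t) i = row (A t) j"
      by (rule eq_vecI) (use ij eq in \<open>auto simp: A_def\<close>)
  qed (use ij in auto)
  have PQ: "poly P t = poly Q t" for t
  proof (cases "inj_on x {..<n}")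
    case True
    have "P = Q"
    proof (rule poly_eqI_degree_lead_coeff[where A = "x ` {..<n}" and n = n])
      have "monic (\<Prod>i<n. [:- x i, 1:])"
        by (rule monic_prod) simp
      moreover have deg: "degree (\<Prod>i<n. [:- x i, 1:]) = n"
        by (subst degree_prod_eq_sum_degree) auto
      ultimately have "Polynomial.coeff Q n = vandermonde n x"
        by (simp add: Q_def)
      moreover have "Polynomial.coeff P n = c n"
        by (simp add: P_def coeff_sum)
      ultimately show "Polynomial.coeff P n = Polynomial.coeff Q n"
        by (simp add: cn)
      show "degree P \<le> n"
        unfolding P_def by (intro degree_sum_le) (auto intro: order_trans[OF degree_monom_le])
      show "degree Q \<le> n"
        using deg unfolding Q_def by (metis degree_smult_le)
      show "n \<le> card (x ` {..<n})"
        using True by (simp add: card_image)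
      show "poly P z = poly Q z" if "z \<in> x ` {..<n}" for z
        using that dbl[of _ n z] by (auto simp: Q_def poly_prod)
    qed
    then show ?thesis by simp
  next
    case False
    then obtain i j where ij: "i < j" "j < n" "x i = x j"
      unfolding inj_on_def by (metis lessThan_iff linorder_neqE_nat)
    then have "\<exists>c\<in>{..<n}. \<exists>b\<in>{..<c}. x c - x b = 0"
      by (intro bexI[of _ j] bexI[of _ i]) auto
    then have "vandermonde n x = 0"
      by (simp add: vandermonde_def)
    then show ?thesis
      using dbl[of i j t] ij by (simp add: Q_def)
  qed
  have "mat (Suc n) (Suc n) (\<lambda>(a, b). x a ^ b) = A (x n)"
    by (rule eq_matI) (auto simp: A_def)
  then have "Determinant.det (mat (Suc n) (Suc n) (\<lambda>(a, b). x a ^ b)) = poly Q (x n)"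
    by (simp add: P flip: PQ)
  also have "\<dots> = vandermonde (Suc n) x"
    by (simp add: Q_def poly_prod vandermonde_def)
  finally show ?case .
qed

lemma det_mat_Leibniz:
  "Determinant.det (mat n n h) = (\<Sum>p | p permutes {..<n}. signof p * (\<Prod>i<n. h (i, p i)))"
proof -
  have "Determinant.det (mat n n h) =
      (\<Sum>p | p permutes {0..<n}. signof p * (\<Prod>i = 0..<n. mat n n h $$ (i, p i)))"
    by (rule det_def') simp
  also have "\<dots> = (\<Sum>p | p permutes {0..<n}. signof p * (\<Prod>i = 0..<n. h (i, p i)))"
    by (intro sum.cong prod.cong arg_cong2[where f = "(*)"] refl index_mat)
      (auto simp: permutes_in_image)
  finally show ?thesis
    by (simp add: lessThan_atLeast0)
qed

text \<open>
  Andreief's identity. By the Leibniz formula and Fubini the integral is a sum over pairs \<open>(p, q)\<close> of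
  permutations; for fixed \<open>p\<close> the sum over \<open>q\<close> is the determinant of the Gram matrix with rows permuted by \<open>p\<close>,
  whose sign cancels that of \<open>p\<close>.
\<close>

lemma Andreief:
  fixes f g :: "nat \<Rightarrow> real \<Rightarrow> real"
  assumes int: "\<And>a b. a < n \<Longrightarrow> b < n \<Longrightarrow> integrable lborel (\<lambda>x. f a x * g b x)"
  shows "has_bochner_integral (Rn n)
    (\<lambda>x. Determinant.det (mat n n (\<lambda>(i, a). f a (x i))) * Determinant.det (mat n n (\<lambda>(i, b). g b (x i))))
    (fact n * Determinant.det (mat n n (\<lambda>(a, b). \<integral>x. f a x * g b x \<partial>lborel)))"
proof -
  interpret product_sigma_finite "\<lambda>_::nat. lborel :: real measure" ..
  let ?S = "{p. p permutes {..<n}}"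
  define I where "I a b = (\<integral>x. f a x * g b x \<partial>lborel)" for a b
  have perm: "p i < n" if "p \<in> ?S" "i < n" for p i
    using that permutes_in_image[of p "{..<n}" i] by auto
  have summand: "has_bochner_integral (Rn n)
      (\<lambda>x. signof p * signof q * (\<Prod>i<n. f (p i) (x i) * g (q i) (x i)))
      (signof p * signof q * (\<Prod>i<n. I (p i) (q i)))" if "p \<in> ?S" "q \<in> ?S" for p q
  proof (rule has_bochner_integral_mult_right)
    have "integrable lborel (\<lambda>x. f (p i) x * g (q i) x)" if "i < n" for i
      using int[OF perm[OF \<open>p \<in> ?S\<close> that] perm[OF \<open>q \<in> ?S\<close> that]] .
    then show "has_bochner_integral (Rn n) (\<lambda>x. \<Prod>i<n. f (p i) (x i) * g (q i) (x i))
        (\<Prod>i<n. I (p i) (q i))"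
      unfolding I_def has_bochner_integral_iff
      by (intro conjI product_integrable_prod product_integral_prod) auto
  qed
  have "has_bochner_integral (Rn n)
      (\<lambda>x. \<Sum>p\<in>?S. \<Sum>q\<in>?S. signof p * signof q * (\<Prod>i<n. f (p i) (x i) * g (q i) (x i)))
      (\<Sum>p\<in>?S. \<Sum>q\<in>?S. signof p * signof q * (\<Prod>i<n. I (p i) (q i)))"
    by (intro has_bochner_integral_sum summand)
  also have "(\<lambda>x. \<Sum>p\<in>?S. \<Sum>q\<in>?S. signof p * signof q * (\<Prod>i<n. f (p i) (x i) * g (q i) (x i))) =
    (\<lambda>x. Determinant.det (mat n n (\<lambda>(i, a). f a (x i))) * Determinant.det (mat n n (\<lambda>(i, b). g b (x i))))"
    unfolding det_mat_Leibniz sum_product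
    by (intro ext sum.cong refl) (simp add: prod.distrib)
  also have "(\<Sum>p\<in>?S. \<Sum>q\<in>?S. signof p * signof q * (\<Prod>i<n. I (p i) (q i))) =
      (\<Sum>p\<in>?S. Determinant.det (mat n n (\<lambda>(a, b). I a b)))"
  proof (intro sum.cong refl)
    fix p assume p: "p \<in> ?S"
    have "Determinant.det (mat n n (\<lambda>(i, b). I (p i) b)) =
        Determinant.det (mat n n (\<lambda>(i, j). mat n n (\<lambda>(a, b). I a b) $$ (p i, j)))"
      by (intro arg_cong[where f = Determinant.det] eq_matI) (use p perm in auto)
    also have "\<dots> = signof p * Determinant.det (mat n n (\<lambda>(a, b). I a b))"
      using p by (intro det_permute_rows) (auto simp: lessThan_atLeast0)
    also have "Determinant.det (mat n n (\<lambda>(i, b). I (p i) b)) =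
        (\<Sum>q\<in>?S. signof q * (\<Prod>i<n. I (p i) (q i)))"
      by (simp only: det_mat_Leibniz prod.case)
    finally have "(\<Sum>q\<in>?S. signof q * (\<Prod>i<n. I (p i) (q i))) =
        signof p * Determinant.det (mat n n (\<lambda>(a, b). I a b))" .
    then have "signof p * (\<Sum>q\<in>?S. signof q * (\<Prod>i<n. I (p i) (q i))) =
        (signof p * signof p) * Determinant.det (mat n n (\<lambda>(a, b). I a b))"
      by (simp add: mult.assoc)
    also have "signof p * signof p = (1::real)"
      by (simp add: sign_def)
    finally show "(\<Sum>q\<in>?S. signof p * signof q * (\<Prod>i<n. I (p i) (q i))) =
        Determinant.det (mat n n (\<lambda>(a, b). I a b))"
      by (simp only: sum_distrib_left mult.assoc mult_1)
  qed
  also have "\<dots> = fact n * Determinant.det (mat n n (\<lambda>(a, b). I a b))"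
    by (simp add: card_permutations[of "{..<n}" n])
  finally show ?thesis
    by (simp add: I_def)
qed

text \<open>
  For an eigenvector \<open>v\<close>, the form \<open>v\<^sup>* A v\<close> equals \<open>k\<close> times the squared norm of \<open>v\<close>, and is its own
  conjugate.
\<close>

lemma hermitian_eigenvalue_real:
  fixes A :: "complex mat"
  assumes A: "A \<in> carrier_mat n n" and h: "mat_adjoint A = A" and e: "eigenvalue A k"
  shows "Im k = 0"
proof -
  have c: "A $$ (i, j) = cnj (A $$ (j, i))" if "i < n" "j < n" for i j
  proof -
    have "A $$ (i, j) = mat_adjoint A $$ (i, j)" by (simp add: h)
    also have "\<dots> = cnj (A $$ (j, i))"
      using A that by (auto simp: mat_adjoint_def mat_of_rows_index)
    finally show ?thesis .
  qed
  obtain v where v: "v \<in> carrier_vec n" "v \<noteq> 0\<^sub>v n" "A *\<^sub>v v = k \<cdot>\<^sub>v v"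
    using e A by (auto simp: eigenvalue_def eigenvector_def)
  have row: "(\<Sum>j<n. A $$ (i, j) * v $ j) = k * v $ i" if "i < n" for i
  proof -
    have "(A *\<^sub>v v) $ i = (\<Sum>j<n. A $$ (i, j) * v $ j)"
      using A v(1) that by (auto simp: scalar_prod_def lessThan_atLeast0 intro!: sum.cong)
    then show ?thesis
      using v that by simp
  qed
  define S where "S = (\<Sum>i<n. \<Sum>j<n. A $$ (i, j) * v $ j * cnj (v $ i))"
  define N where "N = (\<Sum>i<n. (cmod (v $ i))\<^sup>2)"
  have "S = (\<Sum>i<n. k * v $ i * cnj (v $ i))"
    unfolding S_def by (intro sum.cong refl) (simp add: row flip: sum_distrib_right)
  also have "\<dots> = k * complex_of_real N"
    unfolding N_def of_real_sum sum_distrib_left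
    by (intro sum.cong refl) (simp only: mult.assoc complex_norm_square)
  finally have S: "S = k * complex_of_real N" .
  have "cnj S = (\<Sum>i<n. \<Sum>j<n. A $$ (j, i) * v $ i * cnj (v $ j))"
  proof -
    have "cnj (A $$ (i, j) * v $ j * cnj (v $ i)) = A $$ (j, i) * v $ i * cnj (v $ j)"
      if "i < n" "j < n" for i j
      using c[OF that(2,1)] by simp
    then show ?thesis
      unfolding S_def cnj_sum by (intro sum.cong refl) auto
  qed
  also have "\<dots> = S"
    unfolding S_def by (rule sum.swap)
  finally have "Im S = 0"
    by (simp add: complex_eq_iff)
  moreover have "N > 0"
  proof -
    obtain i where "i < n" "v $ i \<noteq> 0"
      using v(1,2) eq_vecI[of v "0\<^sub>v n"] by auto
    then show ?thesis
      unfolding N_def by (intro sum_pos2[of _ i]) auto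
  qed
  ultimately show ?thesis
    using S by simp
qed

lemma hermitian_eigenvalue_tuple:
  assumes "A \<in> space (herm_lborel n)"
  shows "\<exists>x\<in>space (Rn n). eigenvalue_tuple n A x"
proof -
  have A: "A \<in> carrier_mat n n" and h: "mat_adjoint A = A"
    using assms by (auto simp: space_herm_lborel)
  obtain as where cp: "char_poly A = (\<Prod>a\<leftarrow>as. [:- a, 1:])" and len: "length as = n"
    using char_poly_factorized[OF A] by blast
  have real: "complex_of_real (Re a) = a" if "a \<in> set as" for a
  proof -
    have "poly (char_poly A) a = 0"
      using that unfolding cp poly_prod_list by (auto simp: prod_list_zero_iff)
    then have "Im a = 0"
      using hermitian_eigenvalue_real[OF A h] eigenvalue_root_char_poly[OF A] by blast
    then show ?thesis
      by (simp add: complex_eq_iff)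
  qed
  let ?x = "restrict (\<lambda>i. Re (as ! i)) {..<n}"
  have "char_poly A = (\<Prod>i<n. [:- (as ! i), 1:])"
    by (simp add: cp prod.list_conv_set_nth len lessThan_atLeast0)
  also have "\<dots> = (\<Prod>i<n. [:- complex_of_real (?x i), 1:])"
    using real len by (intro prod.cong) auto
  finally have "eigenvalue_tuple n A ?x"
    by (simp add: eigenvalue_tuple_def)
  then show ?thesis
    by (intro bexI[of _ ?x]) (auto simp: space_PiM)
qed

text \<open>
  The matrix of moments in Andreief's identity is triangular, so its determinant is the product
  of its diagonal entries \<open>j! \<integral> \<omega>\<close>.
\<close>

lemma vandermonde_det_integral:
  assumes w: "\<omega> \<in> L1F n"
  shows "has_bochner_integral (Rn n)
    (\<lambda>x. vandermonde n x * Determinant.det (mat n n (\<lambda>(a, b). (minus_D ^^ b) \<omega> (x a))))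
    (fact n * (\<Prod>j<n. (\<integral>x. \<omega> x \<partial>lborel) * fact j))"
proof -
  let ?I = "mat n n (\<lambda>(a, b). \<integral>x. x ^ a * (minus_D ^^ b) \<omega> x \<partial>lborel)"
  have "Determinant.det ?I = prod_list (diag_mat ?I)"
    by (rule det_lower_triangular[where n = n]) (auto simp: moment_minus_D[OF w])
  also have "\<dots> = (\<Prod>j<n. (\<integral>x. \<omega> x \<partial>lborel) * fact j)"
    unfolding prod_list_diag_prod
    by (intro prod.cong) (auto simp: moment_minus_D[OF w] lessThan_atLeast0)
  finally have "Determinant.det ?I = (\<Prod>j<n. (\<integral>x. \<omega> x \<partial>lborel) * fact j)" .
  then show ?thesis
    using Andreief[of n "\<lambda>a x. x ^ a" "\<lambda>b. (minus_D ^^ b) \<omega>"] L1F_minus_D_moment_integrable[OF w]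
    by (simp add: det_power_matrix)
qed

lemma det_mat_transpose:
  "Determinant.det (mat n n (\<lambda>(a, b). h b a)) = Determinant.det (mat n n (\<lambda>(a, b). h a b))"
proof -
  have "transpose_mat (mat n n (\<lambda>(a, b). h a b)) = mat n n (\<lambda>(a, b). h b a)"
    by (rule eq_matI) auto
  then show ?thesis
    using det_transpose[of "mat n n (\<lambda>(a, b). h a b)" n] by simp
qed

lemma comp_permutes_space_Rn:
  assumes "x \<in> space (Rn n)" "\<sigma> permutes {..<n}"
  shows "x \<circ> \<sigma> \<in> space (Rn n)"
  using assms by (auto simp: space_PiM PiE_iff extensional_def permutes_not_in)

lemma joint_eigenvalue_density_cong:
  assumes eq: "\<And>x. x \<in> space (Rn n) \<Longrightarrow> \<rho> x = \<rho>' x"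
    and j: "joint_eigenvalue_density M n X \<rho>"
  shows "joint_eigenvalue_density M n X \<rho>'"
proof -
  have "\<rho>' \<in> borel_measurable (Rn n)"
    using j eq by (auto simp: joint_eigenvalue_density_def cong: measurable_cong)
  moreover have "(\<integral>\<^sup>+x\<in>B. ennreal (\<rho> x) \<partial>Rn n) = (\<integral>\<^sup>+x\<in>B. ennreal (\<rho>' x) \<partial>Rn n)" for B
    using eq by (intro nn_integral_cong) simp
  ultimately show ?thesis
    using j comp_permutes_space_Rn[of _ n] eq unfolding joint_eigenvalue_density_def by simp
qed

text \<open>
  The whole space is a permutation invariant event, and it contains the eigenvalues of every Hermitian
  matrix.
\<close>

lemma joint_eigenvalue_density_total:
  assumes M: "prob_space M" and X: "X \<in> measurable M (herm_lborel n)"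
    and j: "joint_eigenvalue_density M n X \<rho>"
  shows "(\<integral>\<^sup>+x. ennreal (\<rho> x) \<partial>Rn n) = 1"
proof -
  interpret prob_space M by fact
  have "{\<omega>\<in>space M. \<exists>x\<in>space (Rn n). eigenvalue_tuple n (X \<omega>) x} = space M"
    using hermitian_eigenvalue_tuple measurable_space[OF X] by blast
  moreover have "emeasure M {\<omega>\<in>space M. \<exists>x\<in>space (Rn n). eigenvalue_tuple n (X \<omega>) x} =
      (\<integral>\<^sup>+x\<in>space (Rn n). ennreal (\<rho> x) \<partial>Rn n)"
    using j comp_permutes_space_Rn[of _ n] sets.top[of "Rn n"] unfolding joint_eigenvalue_density_def by blast
  moreover have "(\<integral>\<^sup>+x\<in>space (Rn n). ennreal (\<rho> x) \<partial>Rn n) = (\<integral>\<^sup>+x. ennreal (\<rho> x) \<partial>Rn n)"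
    by (intro nn_integral_cong) simp
  ultimately show ?thesis
    by (simp add: emeasure_space_1)
qed

text \<open>
  The unknown constant \<open>C\<close> of the ensemble satisfies \<open>C Z = 1\<close> for the integral \<open>Z\<close> of the unnormalised
  density, and \<open>Z\<close> is a multiple of the \<open>n\<close>-th power of \<open>\<integral> \<omega>\<close>. So \<open>C = 1 / Z\<close>, and \<open>\<integral> \<omega>\<close> is not \<open>0\<close>
  because \<open>n \<ge> 1\<close>.
\<close>

lemma polya_ensemble_density:
  assumes n: "n \<ge> 1" and P: "polya_ensemble M n X \<omega>"
  shows "fourier \<omega> 0 \<noteq> 0"
    and "joint_eigenvalue_density M n X (polya_density n \<omega>)"
    and "proportional_to_vandermonde_det n (\<lambda>j. (minus_D ^^ j) \<omega>) (polya_density n \<omega>)"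
proof -
  have w: "\<omega> \<in> L1F n" and M: "prob_space M"
    using P by (auto simp: polya_ensemble_def)
  obtain f where "distributed M (herm_lborel n) X f"
    using P by (auto simp: polya_ensemble_def)
  then have X: "X \<in> measurable M (herm_lborel n)"
    by (rule distributed_measurable)
  obtain \<rho> C where \<rho>: "joint_eigenvalue_density M n X \<rho>" and C: "C > 0"
    and \<rho>_eq: "\<And>x. x \<in> space (Rn n) \<Longrightarrow> \<rho> x =
      C * (vandermonde n x * Determinant.det (mat n n (\<lambda>(b, c). (minus_D ^^ b) \<omega> (x c))))"
    using P by (auto simp: polya_ensemble_def proportional_to_vandermonde_det_def)
  let ?V = "\<lambda>x. vandermonde n x * Determinant.det (mat n n (\<lambda>(a, b). (minus_D ^^ b) \<omega> (x a)))"
  define Z where "Z = fact n * (\<Prod>j<n. (\<integral>x. \<omega> x \<partial>lborel) * fact j)"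
  have \<rho>_V: "\<rho> x = C * ?V x" if "x \<in> space (Rn n)" for x
    using \<rho>_eq[OF that] det_mat_transpose[of n "\<lambda>b a. (minus_D ^^ b) \<omega> (x a)"] by simp
  have "has_bochner_integral (Rn n) (\<lambda>x. C * ?V x) (C * Z)"
    unfolding Z_def by (intro has_bochner_integral_mult_right vandermonde_det_integral[OF w])
  then have int: "has_bochner_integral (Rn n) \<rho> (C * Z)"
    by (subst has_bochner_integral_cong[OF refl \<rho>_V refl])
  have "(\<integral>\<^sup>+x. ennreal (\<rho> x) \<partial>Rn n) = ennreal (C * Z)"
    using int \<rho> by (subst nn_integral_eq_integral)
      (auto simp: has_bochner_integral_iff joint_eigenvalue_density_def)
  then have CZ: "C * Z = 1"
    using joint_eigenvalue_density_total[OF M X \<rho>] by (simp add: ennreal_eq_1)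
  then have "(\<integral>x. \<omega> x \<partial>lborel) \<noteq> 0"
    using n by (auto simp: Z_def power_0_left)
  then show "fourier \<omega> 0 \<noteq> 0"
    by (simp add: fourier_at_0)
  have "C = 1 / Z"
    using CZ by (metis mult_zero_right nonzero_eq_divide_eq zero_neq_one)
  then have "C = 1 / fact n * (\<Prod>j<n. 1 / (Re (fourier \<omega> 0) * fact j))"
    by (simp add: Z_def fourier_at_0 prod_dividef)
  then have pd: "polya_density n \<omega> x = C * ?V x" for x
    by (simp add: polya_density_def)
  show "joint_eigenvalue_density M n X (polya_density n \<omega>)"
    by (rule joint_eigenvalue_density_cong[OF _ \<rho>]) (simp only: pd \<rho>_V)
  show "proportional_to_vandermonde_det n (\<lambda>j. (minus_D ^^ j) \<omega>) (polya_density n \<omega>)"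
    unfolding proportional_to_vandermonde_det_def
  proof (intro exI[of _ C] conjI ballI C)
    fix x assume x: "x \<in> space (Rn n)"
    show "polya_density n \<omega> x =
        C * (vandermonde n x * Determinant.det (mat n n (\<lambda>(b, c). (minus_D ^^ b) \<omega> (x c))))"
      by (rule trans[OF trans[OF pd \<rho>_V[OF x, symmetric]] \<rho>_eq[OF x]])
  qed
qed

theorem mainTheorem1:
  fixes n :: nat and \<omega> :: "real \<Rightarrow> real"
    and M :: "'a measure" and X :: "'a \<Rightarrow> complex mat"
  assumes "n \<ge> 1"
    and "\<omega> \<in> L1F n"
    and "polya_ensemble M n X \<omega>"
  shows "joint_eigenvalue_density M n X (polya_density n \<omega>)
    \<and> described_by_biorthonormal n (polya_density n \<omega>) (\<lambda>j. (minus_D ^^ j) \<omega>)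
        (polya_p \<omega>) (polya_q \<omega>)
    \<and> (\<forall>y' y. set_integrable lborel {0..} (\<lambda>s. complex_of_real (exp (- s)) *
            (kernel_operator s y' ^^ (n - 1)) (\<lambda>t y. complex_of_real (\<omega> y) / fourier \<omega> t) 0 y)
        \<and> biorthonormal_kernel n (polya_p \<omega>) (polya_q \<omega>) y' y =
            1 / fact (n - 1) * (LBINT s:{0..}. complex_of_real (exp (- s)) *
              (kernel_operator s y' ^^ (n - 1))
                (\<lambda>t y. complex_of_real (\<omega> y) / fourier \<omega> t) 0 y))"
proof (intro conjI allI)
  note nz = polya_ensemble_density(1)[OF assms(1,3)]
  note kernel = polya_kernel[OF assms(1,2) nz, unfolded has_bochner_integral_iff]
  show "joint_eigenvalue_density M n X (polya_density n \<omega>)"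
    by (rule polya_ensemble_density(2)[OF assms(1,3)])
  have "complex_lin_span n (polya_q \<omega>) =
      complex_lin_span n (\<lambda>j x. complex_of_real ((minus_D ^^ j) \<omega> x))"
    by (simp add: complex_lin_span_def polya_q_def)
  then show "described_by_biorthonormal n (polya_density n \<omega>) (\<lambda>j. (minus_D ^^ j) \<omega>)
      (polya_p \<omega>) (polya_q \<omega>)"
    unfolding described_by_biorthonormal_def
    using polya_ensemble_density(3)[OF assms(1,3)] polya_biorthonormal[OF assms(2) nz]
      polya_p_span[OF assms(2) nz] by blast
  fix y' y
  show "set_integrable lborel {0..} (\<lambda>s. complex_of_real (exp (- s)) *
      (kernel_operator s y' ^^ (n - 1)) (\<lambda>t y. complex_of_real (\<omega> y) / fourier \<omega> t) 0 y)"
    using kernel unfolding set_integrable_def by blast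
  show "biorthonormal_kernel n (polya_p \<omega>) (polya_q \<omega>) y' y =
      1 / fact (n - 1) * (LBINT s:{0..}. complex_of_real (exp (- s)) *
        (kernel_operator s y' ^^ (n - 1)) (\<lambda>t y. complex_of_real (\<omega> y) / fourier \<omega> t) 0 y)"
    using kernel[of y' y] unfolding set_lebesgue_integral_def by simp
qed

end
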